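(* Let $n$ be odd and consider a linear $\mathbf{D}_n$-symmetric system of $n$ delay-coupled one-dimensional cells depending on $k$ delays $\tau_1,\ldots,\tau_k$, with characteristic equation $$\det\Delta(\lambda)=\Delta_0(\lambda)\prod_{j=1}^{(n-1)/2}[\Delta_j(\lambda)]^2=0$$ where the factors $\Delta_j$ are as given in the context. Let $i_1<i_2<\cdots<i_s$ be indices chosen from $\{0,\ldots,(n-1)/2\}$, defining a combination of factors of this characteristic equation. Let $\mathcal{B}$ be the $s\times s$ matrix defined as follows: if $i_1\geq 1$, $$\mathcal{B}_{pq}=4\cos\left(\frac{2\pi i_p i_q}{n}\right),\qquad 1\leq p,q\leq s;$$ if $i_1=0$, $\mathcal{B}_{p1}=1$ for $1\leq p\leq s$ and $$\mathcal{B}_{pq}=4\cos\left(\frac{2\pi i_p i_q}{n}\right),\qquad 1\leq p\leq s,\ 2\leq q\leq s.$$ Assume that $\mathcal{B}$ is nonsingular. Suppose that $$\omega_1^1,\ldots,\omega_{\ell_{i_1}}^1,\ \omega_1^2,\ldots,\omega_{\ell_{i_2}}^2,\ \ldots,\ \omega_1^s,\ldots,\omega_{\ell_{i_s}}^s$$ are positive and linearly independent over the rationals, where $\ell_{i_1},\ldots,\ell_{i_s}$ are positive integers with $\ell_{i_1}+\cdots+\ell_{i_s}=k$. Then there exist $\tau_1>0,\ldots,\tau_k>0$ and real coefficients $a_1,\ldots,a_k$ such that for all $m=1,\ldots,s$ the equation $$\Delta_{i_m}(\lambda)=0$$ has roots $i\omega_\ell^m$ for $\ell=1,\ldots,\ell_{i_m}$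 (here $i$ in $i\omega^m_\ell$ is the imaginary unit).
   Context: $\mathbf{D}_n$-symmetric system: a linear delay equation $\dot X=\int_{-\tau}^{0}d\eta(\theta)X(t+\theta)$ on $\mathbb{R}^n$ (one scalar variable per cell) with finitely many discrete delays, whose $\eta(\theta)$ commutes with the dihedral group $\mathbf{D}_n$ acting by cyclic rotations $(x_1,\ldots,x_n)\mapsto(x_n,x_1,\ldots,x_{n-1})$ and the reflection $(x_1,x_2,\ldots,x_n)\mapsto(x_1,x_n,\ldots,x_2)$. For $j=0,\ldots,(n-1)/2$ the factors of the characteristic equation are $$\Delta_j(\lambda)=\lambda-F(\lambda)-G_j(\lambda),\qquad F(\lambda)=\sum_{i=1}^{p}\alpha_i\,e^{-\lambda\sigma_i},$$ $$G_j(\lambda)=\sum_{q=2}^{(n+1)/2}4\cos\left(\frac{2\pi(q-1)j}{n}\right)\sum_{t=1}^{m_q}\alpha_t^{q}\,e^{-\lambda s_t^{q}},$$ where $F$ comes from the internal dynamics of each cell, $m_q$ is the number of delayed terms in the connection from cell $q$ to cell $1$, $\alpha_t^q$ are the corresponding coupling coefficients, and $p\geq 1$. The delays $\sigma_i$ and $s_t^q$ taken together are the $k$ delays $\tau_1,\ldots,\tau_k$, so $k=p+\sum_{q}m_q$, and the coefficients $\alpha_i$ and $\alpha_t^q$ taken together (in the same order) are the real coefficients $a_1,\ldots,a_k$. The delays and coefficients are free to be chosen in the conclusion. Superscripts on $\omega_\ell^m$, $\alpha_t^q$, $s_t^q$ are indices. *)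

theory Defs
  imports Complex_Main "Jordan_Normal_Form.Determinant"
begin

section \<open>Symmetric delay systems with discrete delays\<close>

text \<open>
  A system X'(t) = (\<Sum>r=1..k. M r * X(t - \<tau> r)) on n cells is given by its delays \<tau> r and
  its real n \<times> n matrices M r, r = 1..k. It is the delay equation whose kernel \<open>\<eta>\<close> is the step
  function with jump M r at \<theta> = - \<tau> r. Matrices are indexed from 0, so cell c has row c - 1.
\<close>

definition eta ::
  "nat \<Rightarrow> nat \<Rightarrow> (nat \<Rightarrow> real) \<Rightarrow> (nat \<Rightarrow> real mat) \<Rightarrow> real \<Rightarrow> real mat" where
  "eta n k \<tau> M \<theta> =
     Matrix.mat n n (\<lambda>(x, y). \<Sum>r \<in> {r \<in> {1..k}. - \<tau> r \<le> \<theta>}. M r $$ (x, y))"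

text \<open>The map (x1, ..., xn) \<mapsto> (xn, x1, ..., x(n-1)).\<close>

definition rotation_mat :: "nat \<Rightarrow> real mat" where
  "rotation_mat n = Matrix.mat n n (\<lambda>(x, y). if y = (x + n - 1) mod n then 1 else 0)"

text \<open>The map (x1, x2, ..., xn) \<mapsto> (x1, xn, ..., x2).\<close>

definition reflection_mat :: "nat \<Rightarrow> real mat" where
  "reflection_mat n = Matrix.mat n n (\<lambda>(x, y). if y = (n - x) mod n then 1 else 0)"

text \<open>Commuting with the two generators is the same as commuting with the whole dihedral group.\<close>

definition dihedral_symmetric ::
  "nat \<Rightarrow> nat \<Rightarrow> (nat \<Rightarrow> real) \<Rightarrow> (nat \<Rightarrow> real mat) \<Rightarrow> bool" where
  "dihedral_symmetric n k \<tau> M \<longleftrightarrow>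
     (\<forall>\<theta>. eta n k \<tau> M \<theta> * rotation_mat n = rotation_mat n * eta n k \<tau> M \<theta> \<and>
          eta n k \<tau> M \<theta> * reflection_mat n = reflection_mat n * eta n k \<tau> M \<theta>)"

text \<open>z I minus the Stieltjes integral of exp (z \<theta>) against \<open>\<eta>\<close>, evaluated for the step function.\<close>

definition char_matrix ::
  "nat \<Rightarrow> nat \<Rightarrow> (nat \<Rightarrow> real) \<Rightarrow> (nat \<Rightarrow> real mat) \<Rightarrow> complex \<Rightarrow> complex mat" where
  "char_matrix n k \<tau> M z =
     Matrix.mat n n (\<lambda>(x, y). (if x = y then z else 0)
       - (\<Sum>r = 1..k. complex_of_real (M r $$ (x, y)) * exp (- z * complex_of_real (\<tau> r))))"

section \<open>The factors of the characteristic equation\<close>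

text \<open>
  The k delays and coefficients are numbered consecutively: the internal terms occupy the positions
  1..p, followed by m 2 terms for the connection from cell 2, then m 3 terms for the connection
  from cell 3, and so on up to cell (n + 1) div 2. Term t of connection q thus has position
  coupling_index p m q t.
\<close>

definition num_delays :: "nat \<Rightarrow> nat \<Rightarrow> (nat \<Rightarrow> nat) \<Rightarrow> nat" where
  "num_delays n p m = p + (\<Sum>q = 2..(n + 1) div 2. m q)"

definition coupling_index :: "nat \<Rightarrow> (nat \<Rightarrow> nat) \<Rightarrow> nat \<Rightarrow> nat \<Rightarrow> nat" where
  "coupling_index p m q t = p + (\<Sum>q' \<in> {2..<q}. m q') + t"

definition internal_term ::
  "nat \<Rightarrow> (nat \<Rightarrow> real) \<Rightarrow> (nat \<Rightarrow> real) \<Rightarrow> complex \<Rightarrow> complex" where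
  "internal_term p \<tau> a z =
     (\<Sum>r = 1..p. complex_of_real (a r) * exp (- z * complex_of_real (\<tau> r)))"

definition coupling_term ::
  "nat \<Rightarrow> nat \<Rightarrow> (nat \<Rightarrow> nat) \<Rightarrow> (nat \<Rightarrow> real) \<Rightarrow> (nat \<Rightarrow> real) \<Rightarrow> nat \<Rightarrow> complex \<Rightarrow> complex" where
  "coupling_term n p m \<tau> a j z =
     (\<Sum>q = 2..(n + 1) div 2.
        complex_of_real (4 * cos (2 * pi * real (q - 1) * real j / real n)) *
        (\<Sum>t = 1..m q. complex_of_real (a (coupling_index p m q t)) *
           exp (- z * complex_of_real (\<tau> (coupling_index p m q t)))))"

definition char_factor ::
  "nat \<Rightarrow> nat \<Rightarrow> (nat \<Rightarrow> nat) \<Rightarrow> (nat \<Rightarrow> real) \<Rightarrow> (nat \<Rightarrow> real) \<Rightarrow> nat \<Rightarrow> complex \<Rightarrow> complex" where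
  "char_factor n p m \<tau> a j z = z - internal_term p \<tau> a z - coupling_term n p m \<tau> a j z"

section \<open>The matrix of a combination of factors\<close>

text \<open>The chosen indices are i 1 < ... < i s; row and column v of the matrix belong to i (v + 1).\<close>

definition combination_mat :: "nat \<Rightarrow> nat \<Rightarrow> (nat \<Rightarrow> nat) \<Rightarrow> real mat" where
  "combination_mat n s i =
     Matrix.mat s s (\<lambda>(u, v). if i 1 = 0 \<and> v = 0 then 1
       else 4 * cos (2 * pi * real (i (u + 1)) * real (i (v + 1)) / real n))"

section \<open>Linear independence over the rationals\<close>

text \<open>
  Independence of a family, not just of its set of values: repeated members count as dependent.
\<close>

definition rat_independent_family :: "('b \<Rightarrow> real) \<Rightarrow> 'b set \<Rightarrow> bool" where
  "rat_independent_family f I \<longleftrightarrow>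
     inj_on f I \<and> \<not> module.dependent (\<lambda>(c :: rat) (x :: real). of_rat c * x) (f ` I)"

end

(*
  Since n is odd, no cosine in the coupling terms vanishes, so every factor has the form
  z - sum_r c_r a_r exp (- z tau_r) with all c_r nonzero. There is one equation per frequency, hence
  k complex equations for the 2k real unknowns tau_r, a_r. By Kronecker's theorem the phases
  exp (- i w_e tau_r) can be brought close to arbitrary points of the unit circle. The target phases are
  chosen near i or - i, with the signs making M = (+-c_er) invertible, so that M a = w holds
  approximately and the derivative in (a, tau) is nearly M on the imaginary parts and diag (w) M diag (a)
  on the real parts. The latter is invertible if no a_r is 0, which a small perturbation of the
  target achieves. A contraction argument then turns the approximate solution into an exact one.
*)

theory Submission
  imports Defs "HOL-Analysis.Kronecker_Approximation_Theorem"
begin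

text \<open>With all phases equal to i or - i, each row is i times a real combination of the
  coefficients, which is why a real system M a = w can meet the purely imaginary right-hand sides. A
  change of coefficients then moves a row along the imaginary axis and a shift of delays along the
  real axis, so the derivative splits into two blocks, both governed by M. Kronecker's theorem gives
  no upper bound on the delays. This is harmless: a base delay enters the equations only through
  numbers of modulus 1, so all Lipschitz constants are known before the delay is picked. The
  obstacle is a zero a_r. If only one a_r is nonzero, then w is a multiple of a column of M, and no
  row has two terms whose rotations could compensate a change of a. Hence the signs must also keep
  every column of M from being parallel to w when k is at least 2. A column of mixed signs is never
  parallel to the positive w, and a constant column is not parallel to it because the frequencies
  are distinct.\<close>

section \<open>Simultaneous approximation of phases\<close>

text \<open>Multiplying an integer relation among the quotients by \<open>s\<close> gives a rational
  relation among the original values. With \<open>s\<close> = 2 pi this is the form of independence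
  that Kronecker's theorem asks for.\<close>

lemma rat_independent_family_imp_int_independent:
  fixes f :: "'b \<Rightarrow> real"
  assumes "rat_independent_family f I" "s \<noteq> 0"
  shows "module.independent (\<lambda>r. (*) (real_of_int r)) ((\<lambda>x. f x / s) ` I)"
proof -
  interpret Z: Modules.module "\<lambda>r. (*) (real_of_int r)"
    by unfold_locales (auto simp: algebra_simps)
  interpret Q: Modules.module "\<lambda>(c::rat) (x::real). of_rat c * x"
    by unfold_locales (auto simp: algebra_simps of_rat_add of_rat_mult)
  have indep: "Q.independent (f ` I)"
    using assms(1) by (simp add: rat_independent_family_def)
  show ?thesis
    unfolding Z.independent_explicit_module
  proof (intro allI impI)
    fix t and u :: "real \<Rightarrow> int" and v
    assume fin: "finite t" and sub: "t \<subseteq> (\<lambda>x. f x / s) ` I"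
      and zero: "(\<Sum>v\<in>t. real_of_int (u v) * v) = 0" and v: "v \<in> t"
    have "(\<Sum>w\<in>(*) s ` t. real_of_rat (of_int (u (w / s))) * w) = s * (\<Sum>v\<in>t. real_of_int (u v) * v)"
      using assms(2) by (subst sum.reindex) (auto simp: inj_on_def sum_distrib_left intro!: sum.cong)
    with zero have "(\<Sum>w\<in>(*) s ` t. real_of_rat (of_int (u (w / s))) * w) = 0"
      by simp
    moreover have "(*) s ` t \<subseteq> f ` I"
      using sub assms(2) by auto
    ultimately have "of_int (u (s * v / s)) = (0::rat)"
      using Q.independentD[OF indep, of "(*) s ` t" "\<lambda>w. of_int (u (w / s))" "s * v"] fin v by auto
    then show "u v = 0"
      using assms(2) by simp
  qed
qed

text \<open>
  Kronecker's theorem gives a time of either sign. By Dirichlet's theorem there are arbitrarily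
  late times at which all the phases almost return to 0, and adding one of these makes it large.
\<close>

lemma Kronecker_unit_circle_large:
  fixes \<omega> :: "nat \<Rightarrow> real" and u :: "nat \<Rightarrow> complex"
  assumes indep: "rat_independent_family \<omega> {..<k}"
    and u: "\<And>e. e < k \<Longrightarrow> cmod (u e) = 1" and "\<epsilon> > 0"
  obtains \<tau> where "\<tau> > B"
    and "\<And>e. e < k \<Longrightarrow> cmod (exp (- (\<i> * of_real (\<omega> e)) * of_real \<tau>) - u e) < \<epsilon>"
proof -
  define \<theta> where "\<theta> = (\<lambda>e. \<omega> e / (2 * pi))"
  \<comment> \<open>Two errors below \<open>\<delta>\<close>, one from Kronecker and one from
    Dirichlet, are measured in full turns; 2 pi times their sum is below
    \<open>\<epsilon>\<close>.\<close>
  define \<delta> where "\<delta> = \<epsilon> / (4 * pi)"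
  have "\<delta> > 0"
    using \<open>\<epsilon> > 0\<close> by (simp add: \<delta>_def)
  have inj: "inj_on \<theta> {..<k}"
    using indep by (auto simp: rat_independent_family_def \<theta>_def inj_on_def)
  have ind: "module.independent (\<lambda>r. (*) (real_of_int r)) (\<theta> ` {..<k})"
    using rat_independent_family_imp_int_independent[OF indep, of "2 * pi"]
    by (simp add: \<theta>_def)
  obtain t h where th: "\<And>e. e < k \<Longrightarrow> \<bar>t * \<theta> e - of_int (h e) - (- Arg (u e) / (2 * pi))\<bar> < \<delta>"
    using Kronecker_thm_1[OF ind inj \<open>\<delta> > 0\<close>, of "\<lambda>e. - Arg (u e) / (2 * pi)"] by blast
  obtain N :: nat where N: "N > 0" "1 / real N < \<delta>"
    using \<open>\<delta> > 0\<close> by (metis nat_approx_posE zero_less_Suc)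
  \<comment> \<open>Any positive integer multiple of \<open>D\<close> pushes \<open>t\<close> beyond
    \<open>B\<close>. Dirichlet's theorem is applied to the phases gained in time \<open>D\<close>,
    so that some multiple brings all of them close to whole turns.\<close>
  define D where "D = \<bar>t\<bar> + \<bar>B\<bar> + 1"
  obtain q p where q: "0 < q"
    and qp: "\<And>e. e < k \<Longrightarrow> \<bar>of_int q * (D * \<theta> e) - of_int (p e)\<bar> < 1 / N"
    using Dirichlet_approx_simult[OF N(1), of k "\<lambda>e. D * \<theta> e"] by metis
  define \<tau> where "\<tau> = t + of_int q * D"
  have "1 * D \<le> of_int q * D"
    using q by (intro mult_right_mono) (auto simp: D_def)
  then have "\<tau> > B"
    by (auto simp: \<tau>_def D_def)
  moreover have "cmod (exp (- (\<i> * of_real (\<omega> e)) * of_real \<tau>) - u e) < \<epsilon>" if e: "e < k" for e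
  proof -
    \<comment> \<open>The phase error at time \<open>\<tau>\<close>, with the whole turns removed so
      that it is small as a real number.\<close>
    define y where "y = - (\<omega> e * \<tau>) - Arg (u e) + 2 * pi * of_int (h e + p e)"
    have "y = - (2 * pi) * ((t * \<theta> e - of_int (h e) - (- Arg (u e) / (2 * pi)))
        + (of_int q * (D * \<theta> e) - of_int (p e)))"
      by (simp add: y_def \<tau>_def \<theta>_def field_simps)
    then have "\<bar>y\<bar> = 2 * pi * \<bar>(t * \<theta> e - of_int (h e) - (- Arg (u e) / (2 * pi)))
        + (of_int q * (D * \<theta> e) - of_int (p e))\<bar>"
      by (simp add: abs_mult)
    also have "\<dots> < 2 * pi * (2 * \<delta>)"
      using th[OF e] qp[OF e] N(2) by (intro mult_strict_left_mono) auto
    finally have y: "\<bar>y\<bar> < \<epsilon>"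
      by (simp add: \<delta>_def)
    have ue: "u e = exp (\<i> * of_real (Arg (u e)))"
      using u[OF e] by (metis Arg_eq mult_1 norm_zero of_real_1 zero_neq_one)
    have "exp (- (\<i> * of_real (\<omega> e)) * of_real \<tau>)
        = exp (\<i> * of_real (Arg (u e)) + \<i> * of_real y + \<i> * (of_int (- (h e + p e)) * (of_real pi * 2)))"
      by (simp add: y_def algebra_simps)
    also have "\<dots> = u e * exp (\<i> * of_real y)"
      by (simp only: exp_2pi_1_int exp_add mult_1_right flip: ue)
    finally have "cmod (exp (- (\<i> * of_real (\<omega> e)) * of_real \<tau>) - u e) = cmod (u e * (exp (\<i> * of_real y) - 1))"
      by (simp add: algebra_simps)
    also have "\<dots> = 2 * \<bar>sin (y / 2)\<bar>"
      using u[OF e] by (simp add: norm_mult dist_exp_i_1)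
    also have "\<dots> \<le> \<bar>y\<bar>"
      using abs_sin_x_le_abs_x[of "y / 2"] by simp
    finally show ?thesis
      using y by simp
  qed
  ultimately show ?thesis
    using that by blast
qed

section \<open>Zeros of maps close to an invertible linear map\<close>

text \<open>The iteration x - P N(x) contracts with factor 1/2 on the ball of radius
  \<open>\<rho>\<close> in the sum norm, and it moves 0 by at most \<open>\<rho>\<close> / 2, so it
  stays in the ball. \<open>PM\<close> gives the contraction; \<open>MP\<close> is what turns P N(x)
  = 0 into N(x) = 0. Differentiability of \<open>N\<close> is replaced by a Lipschitz bound on its
  difference from \<open>M\<close>.\<close>

lemma simplified_newton_zero:
  fixes M P :: "nat \<Rightarrow> nat \<Rightarrow> real" and N :: "(nat \<Rightarrow> complex) \<Rightarrow> nat \<Rightarrow> complex"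
  assumes MP: "\<And>e e'. e < k \<Longrightarrow> e' < k \<Longrightarrow> (\<Sum>r<k. M e r * P r e') = (if e = e' then 1 else 0)"
    and PM: "\<And>r r'. r < k \<Longrightarrow> r' < k \<Longrightarrow> (\<Sum>e<k. P r e * M e r') = (if r = r' then 1 else 0)"
    and lip: "\<And>x y e. e < k \<Longrightarrow> (\<Sum>r<k. cmod (x r)) \<le> \<rho> \<Longrightarrow> (\<Sum>r<k. cmod (y r)) \<le> \<rho> \<Longrightarrow>
        cmod (N x e - N y e - (\<Sum>r<k. of_real (M e r) * (x r - y r))) \<le> \<epsilon> * (\<Sum>r<k. cmod (x r - y r))"
    and K: "(\<Sum>r<k. \<Sum>e<k. \<bar>P r e\<bar>) * \<epsilon> \<le> 1 / 2"
    and N0: "\<And>e. e < k \<Longrightarrow> cmod (N (\<lambda>_. 0) e) \<le> \<eta>"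
    and \<eta>: "(\<Sum>r<k. \<Sum>e<k. \<bar>P r e\<bar>) * \<eta> \<le> \<rho> / 2"
    and "\<rho> \<ge> 0"
  shows "\<exists>x. (\<Sum>r<k. cmod (x r)) \<le> \<rho> \<and> (\<forall>e<k. N x e = 0)"
proof -
  define nm :: "(nat \<Rightarrow> complex) \<Rightarrow> real" where "nm = (\<lambda>x. \<Sum>r<k. cmod (x r))"
  define K where "K = (\<Sum>r<k. \<Sum>e<k. \<bar>P r e\<bar>)"
  define T where "T = (\<lambda>x r. x r - (\<Sum>e<k. of_real (P r e) * N x e))"
  have nm_nonneg: "nm x \<ge> 0" for x
    by (simp add: nm_def sum_nonneg)
  have nm_P: "nm (\<lambda>r. \<Sum>e<k. of_real (P r e) * v e) \<le> K * b"
    if "\<And>e. e < k \<Longrightarrow> cmod (v e) \<le> b" for v b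
  proof -
    have "nm (\<lambda>r. \<Sum>e<k. of_real (P r e) * v e) \<le> (\<Sum>r<k. \<Sum>e<k. \<bar>P r e\<bar> * b)"
      unfolding nm_def
      by (intro sum_mono order.trans[OF norm_sum] sum_mono)
         (auto simp: norm_mult intro!: mult_left_mono that)
    then show ?thesis
      by (simp add: K_def sum_distrib_right)
  qed
  have P_M: "(\<Sum>e<k. of_real (P r e) * (\<Sum>r'<k. of_real (M e r') * v r')) = v r"
    if r: "r < k" for r and v :: "nat \<Rightarrow> complex"
  proof -
    have "(\<Sum>e<k. of_real (P r e) * (\<Sum>r'<k. of_real (M e r') * v r'))
        = (\<Sum>e<k. \<Sum>r'<k. of_real (P r e * M e r') * v r')"
      by (simp add: sum_distrib_left mult.assoc)
    also have "\<dots> = (\<Sum>r'<k. of_real (\<Sum>e<k. P r e * M e r') * v r')"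
      by (subst sum.swap) (simp add: sum_distrib_right)
    also have "\<dots> = (\<Sum>r'<k. if r = r' then v r' else 0)"
      by (intro sum.cong) (use r in \<open>auto simp: PM simp del: of_real_sum\<close>)
    finally show ?thesis
      using r by simp
  qed
  have M_P: "(\<Sum>r<k. of_real (M e r) * (\<Sum>e'<k. of_real (P r e') * v e')) = v e"
    if e: "e < k" for e and v :: "nat \<Rightarrow> complex"
  proof -
    have "(\<Sum>r<k. of_real (M e r) * (\<Sum>e'<k. of_real (P r e') * v e'))
        = (\<Sum>r<k. \<Sum>e'<k. of_real (M e r * P r e') * v e')"
      by (simp add: sum_distrib_left mult.assoc)
    also have "\<dots> = (\<Sum>e'<k. of_real (\<Sum>r<k. M e r * P r e') * v e')"
      by (subst sum.swap) (simp add: sum_distrib_right)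
    also have "\<dots> = (\<Sum>e'<k. if e = e' then v e' else 0)"
      by (intro sum.cong) (use e in \<open>auto simp: MP simp del: of_real_sum\<close>)
    finally show ?thesis
      using e by simp
  qed
  have contraction: "nm (\<lambda>r. T x r - T y r) \<le> nm (\<lambda>r. x r - y r) / 2"
    if xy: "nm x \<le> \<rho>" "nm y \<le> \<rho>" for x y
  proof -
    \<comment> \<open>Since P M = 1, the linear parts cancel in T x - T y and only \<open>P\<close>
      applied to this remainder is left.\<close>
    define E where "E = (\<lambda>e. N x e - N y e - (\<Sum>r<k. of_real (M e r) * (x r - y r)))"
    have "T x r - T y r = - (\<Sum>e<k. of_real (P r e) * E e)" if "r < k" for r
    proof -
      have "(\<Sum>e<k. of_real (P r e) * E e) = (\<Sum>e<k. of_real (P r e) * N x e)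
          - (\<Sum>e<k. of_real (P r e) * N y e) - (x r - y r)"
        by (simp add: E_def right_diff_distrib sum_subtractf
            P_M[OF that, of "\<lambda>r. x r - y r", unfolded right_diff_distrib sum_subtractf])
      then show ?thesis
        by (simp add: T_def)
    qed
    then have "nm (\<lambda>r. T x r - T y r) = nm (\<lambda>r. \<Sum>e<k. of_real (P r e) * E e)"
      by (simp add: nm_def)
    also have "\<dots> \<le> K * (\<epsilon> * nm (\<lambda>r. x r - y r))"
      using lip xy by (intro nm_P) (auto simp: E_def nm_def)
    also have "\<dots> \<le> 1 / 2 * nm (\<lambda>r. x r - y r)"
      using mult_right_mono[OF K nm_nonneg[of "\<lambda>r. x r - y r"]]
      by (simp add: K_def mult.assoc)
    finally show ?thesis
      by simp
  qed
  define z where "z = (\<lambda>n. (T ^^ n) (\<lambda>_. 0))"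
  have z_Suc: "z (Suc n) = T (z n)" and z_0: "z 0 = (\<lambda>_. 0)" for n
    by (simp_all add: z_def)
  have T0: "nm (T (\<lambda>_. 0)) \<le> \<rho> / 2"
  proof -
    have "nm (T (\<lambda>_. 0)) = nm (\<lambda>r. \<Sum>e<k. of_real (P r e) * N (\<lambda>_. 0) e)"
      by (simp add: T_def nm_def)
    also have "\<dots> \<le> \<rho> / 2"
      using nm_P[of "N (\<lambda>_. 0)" \<eta>] N0 \<eta> by (simp add: K_def)
    finally show ?thesis .
  qed
  have z_ball: "nm (z n) \<le> \<rho>" for n
  proof (induction n)
    case 0
    then show ?case
      using \<open>\<rho> \<ge> 0\<close> by (simp add: z_0 nm_def)
  next
    case (Suc n)
    have "nm (T (z n)) \<le> nm (\<lambda>r. T (z n) r - T (\<lambda>_. 0) r) + nm (T (\<lambda>_. 0))"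
      unfolding nm_def sum.distrib[symmetric]
      by (intro sum_mono) (metis diff_add_cancel norm_triangle_ineq)
    also have "\<dots> \<le> nm (z n) / 2 + \<rho> / 2"
      using contraction[OF Suc, of "\<lambda>_. 0"] T0 \<open>\<rho> \<ge> 0\<close> by (simp add: nm_def)
    finally show ?case
      using Suc by (simp add: z_Suc)
  qed
  have z_step: "nm (\<lambda>r. z (Suc n) r - z n r) \<le> \<rho> * (1 / 2) ^ n" for n
  proof (induction n)
    case 0
    then show ?case
      using T0 \<open>\<rho> \<ge> 0\<close> by (simp add: z_0 z_Suc)
  next
    case (Suc n)
    then show ?case
      using contraction[OF z_ball[of "Suc n"] z_ball[of n]] by (simp add: z_Suc[symmetric])
  qed
  \<comment> \<open>The norm \<open>nm\<close> ignores coordinates from \<open>k\<close> on, so the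
    limit is taken coordinate by coordinate below \<open>k\<close>, from the geometric bound on the
    steps.\<close>
  have conv: "convergent (\<lambda>n. z n r)" if "r < k" for r
  proof -
    have bound: "cmod (z (Suc n) r - z n r) \<le> \<rho> * (1 / 2) ^ n" for n
    proof -
      have "cmod (z (Suc n) r - z n r) \<le> nm (\<lambda>r. z (Suc n) r - z n r)"
        unfolding nm_def using that
        by (intro member_le_sum[of r "{..<k}" "\<lambda>r. cmod (z (Suc n) r - z n r)"]) auto
      with z_step[of n] show ?thesis
        by simp
    qed
    have geometric: "summable (\<lambda>n. \<rho> * (1 / 2) ^ n)"
      by (rule summable_mult, rule summable_geometric) simp
    have "summable (\<lambda>n. z (Suc n) r - z n r)"
      by (rule summable_comparison_test[OF _ geometric]) (use bound in auto)
    then have "convergent (\<lambda>n. \<Sum>j<n. z (Suc j) r - z j r)"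
      by (simp add: summable_iff_convergent)
    then show ?thesis
      by (simp add: sum_lessThan_telescope[of "\<lambda>n. z n r"] z_0)
  qed
  define x where "x = (\<lambda>r. lim (\<lambda>n. z n r))"
  have lim: "(\<lambda>n. z n r) \<longlonglongrightarrow> x r" if "r < k" for r
    using conv[OF that] by (simp add: x_def convergent_LIMSEQ_iff)
  have x_ball: "nm x \<le> \<rho>"
  proof (rule LIMSEQ_le_const2)
    show "(\<lambda>n. nm (z n)) \<longlonglongrightarrow> nm x"
      unfolding nm_def by (intro tendsto_sum tendsto_norm lim) auto
  qed (use z_ball in auto)
  \<comment> \<open>The hypothesis \<open>lip\<close> itself provides the continuity of
    \<open>N\<close> along the sequence, using only the first \<open>k\<close> coordinates.\<close>
  have N_lim: "(\<lambda>n. N (z n) e) \<longlonglongrightarrow> N x e" if e: "e < k" for e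
  proof -
    have "(\<lambda>n. \<epsilon> * (\<Sum>r<k. cmod (z n r - x r))) \<longlonglongrightarrow> \<epsilon> * (\<Sum>r<k. cmod (x r - x r))"
      by (intro tendsto_intros lim) auto
    then have "(\<lambda>n. \<epsilon> * (\<Sum>r<k. cmod (z n r - x r))) \<longlonglongrightarrow> 0"
      by simp
    then have "(\<lambda>n. N (z n) e - N x e - (\<Sum>r<k. of_real (M e r) * (z n r - x r))) \<longlonglongrightarrow> 0"
      by (rule Lim_null_comparison[rotated])
         (use lip[OF e] z_ball x_ball in \<open>auto simp: nm_def\<close>)
    moreover have "(\<lambda>n. \<Sum>r<k. of_real (M e r) * (z n r - x r))
        \<longlonglongrightarrow> (\<Sum>r<k. of_real (M e r) * (x r - x r))"
      by (intro tendsto_intros lim) auto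
    ultimately have "(\<lambda>n. (N (z n) e - N x e - (\<Sum>r<k. of_real (M e r) * (z n r - x r)))
        + (\<Sum>r<k. of_real (M e r) * (z n r - x r))) \<longlonglongrightarrow> 0 + (\<Sum>r<k. of_real (M e r) * (x r - x r))"
      by (rule tendsto_add)
    then show ?thesis
      by (simp add: LIM_zero_iff)
  qed
  have P_zero: "(\<Sum>e<k. of_real (P r e) * N x e) = 0" if r: "r < k" for r
  proof -
    have "(\<lambda>n. z n r - z (Suc n) r) \<longlonglongrightarrow> x r - x r"
      using lim[OF r] LIMSEQ_Suc[OF lim[OF r]] by (rule tendsto_diff)
    moreover have "(\<lambda>n. z n r - z (Suc n) r) = (\<lambda>n. \<Sum>e<k. of_real (P r e) * N (z n) e)"
      by (simp add: z_Suc T_def)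
    moreover have "(\<lambda>n. \<Sum>e<k. of_real (P r e) * N (z n) e) \<longlonglongrightarrow> (\<Sum>e<k. of_real (P r e) * N x e)"
      by (intro tendsto_intros N_lim) auto
    ultimately show ?thesis
      using LIMSEQ_unique by fastforce
  qed
  have "N x e = 0" if "e < k" for e
    using M_P[OF that, of "N x"] P_zero by simp
  with x_ball show ?thesis
    by (auto simp: nm_def)
qed

section \<open>Invertible matrices with prescribed absolute values\<close>

text \<open>One index is reserved for a negative entry and another for a positive one. The sign at
  the third index \<open>e0\<close> stays free, and flipping it changes the sum by 2 \<bar>c
  e0\<bar> g e0, which is nonzero, so at most one of the two choices lies in the hyperplane.\<close>

lemma mixed_sign_vector_avoiding_hyperplane:
  fixes c g :: "nat \<Rightarrow> real"
  assumes "3 \<le> k" and e0: "e0 < k" "g e0 \<noteq> 0" and c: "\<And>e. e < k \<Longrightarrow> c e \<noteq> 0"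
  obtains v where "\<And>e. e < k \<Longrightarrow> \<bar>v e\<bar> = \<bar>c e\<bar>" "\<exists>e<k. v e > 0" "\<exists>e<k. v e < 0"
    "(\<Sum>e<k. v e * g e) \<noteq> 0"
proof -
  have "\<exists>e1 e2. e1 < k \<and> e2 < k \<and> e1 \<noteq> e0 \<and> e2 \<noteq> e0 \<and> e1 \<noteq> e2"
  proof -
    consider "e0 = 0" | "e0 = 1" | "e0 \<noteq> 0" "e0 \<noteq> 1"
      by blast
    then show ?thesis
    proof cases
      case 1
      then show ?thesis
        using assms(1) by (intro exI[of _ "1::nat"] exI[of _ "2::nat"]) simp
    next
      case 2
      then show ?thesis
        using assms(1) by (intro exI[of _ "0::nat"] exI[of _ "2::nat"]) simp
    next
      case 3
      then show ?thesis
        using assms(1) by (intro exI[of _ "0::nat"] exI[of _ "1::nat"]) simp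
    qed
  qed
  then obtain e1 e2 where e12: "e1 < k" "e2 < k" "e1 \<noteq> e0" "e2 \<noteq> e0" "e1 \<noteq> e2"
    by blast
  define v where "v = (\<lambda>s e. if e = e1 then - \<bar>c e\<bar> else if e = e0 then s * \<bar>c e\<bar> else \<bar>c e\<bar>)"
  have "(\<Sum>e<k. v 1 e * g e) - (\<Sum>e<k. v (- 1) e * g e) = (\<Sum>e<k. if e = e0 then 2 * \<bar>c e\<bar> * g e else 0)"
    unfolding sum_subtractf[symmetric] by (intro sum.cong) (use e12 in \<open>auto simp: v_def\<close>)
  also have "\<dots> \<noteq> 0"
    using e0 c by simp
  finally have "\<exists>s\<in>{1, - 1}. (\<Sum>e<k. v s e * g e) \<noteq> 0"
    by auto
  then obtain s where s: "s \<in> {1, - 1}" "(\<Sum>e<k. v s e * g e) \<noteq> 0"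
    by blast
  show ?thesis
  proof (rule that)
    show "\<bar>v s e\<bar> = \<bar>c e\<bar>" for e
      using s(1) by (auto simp: v_def)
    show "\<exists>e<k. v s e > 0"
      using e12 c by (intro exI[of _ e2]) (auto simp: v_def)
    show "\<exists>e<k. v s e < 0"
      using e12 c by (intro exI[of _ e1]) (auto simp: v_def)
  qed (rule s)
qed

text \<open>
  Starting from the identity matrix, the columns are replaced one by one. The determinant is a
  nonzero linear functional of the column to be replaced.
\<close>

lemma mixed_sign_matrix:
  fixes c :: "nat \<Rightarrow> nat \<Rightarrow> real"
  assumes "3 \<le> k" and c: "\<And>e r. e < k \<Longrightarrow> r < k \<Longrightarrow> c e r \<noteq> 0"
  obtains A where "A \<in> carrier_mat k k" "Determinant.det A \<noteq> 0"
    "\<And>e r. e < k \<Longrightarrow> r < k \<Longrightarrow> \<bar>A $$ (e, r)\<bar> = \<bar>c e r\<bar>"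
    "\<And>r. r < k \<Longrightarrow> (\<exists>e<k. A $$ (e, r) > 0) \<and> (\<exists>e<k. A $$ (e, r) < 0)"
proof -
  define good where "good = (\<lambda>(A :: real mat) r. (\<forall>e<k. \<bar>A $$ (e, r)\<bar> = \<bar>c e r\<bar>) \<and>
      (\<exists>e<k. A $$ (e, r) > 0) \<and> (\<exists>e<k. A $$ (e, r) < 0))"
  have "\<exists>A\<in>carrier_mat k k. Determinant.det A \<noteq> 0 \<and> (\<forall>r<j. good A r)" if "j \<le> k" for j
    using that
  proof (induction j)
    case 0
    show ?case
      by (rule bexI[of _ "1\<^sub>m k"]) simp_all
  next
    case (Suc j)
    from Suc.IH Suc.prems obtain A where A: "A \<in> carrier_mat k k" "Determinant.det A \<noteq> 0"
      and cols: "\<forall>r<j. good A r"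
      using Suc_leD by blast
    have "j < k"
      using Suc.prems by simp
    \<comment> \<open>The functional given by the cofactors of column \<open>j\<close> is nonzero
      because its value on the present column is the nonzero determinant.\<close>
    have "\<exists>e<k. cofactor A e j \<noteq> 0"
    proof (rule ccontr)
      assume "\<not> ?thesis"
      then have "(\<Sum>e<k. A $$ (e, j) * cofactor A e j) = 0"
        by (intro sum.neutral) auto
      with laplace_expansion_column[OF A(1) \<open>j < k\<close>] A(2) show False
        by simp
    qed
    then obtain e0 where e0: "e0 < k" "cofactor A e0 j \<noteq> 0"
      by blast
    obtain v where v: "\<And>e. e < k \<Longrightarrow> \<bar>v e\<bar> = \<bar>c e j\<bar>" "\<exists>e<k. v e > 0" "\<exists>e<k. v e < 0"
      "(\<Sum>e<k. v e * cofactor A e j) \<noteq> 0"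
      by (rule mixed_sign_vector_avoiding_hyperplane[OF assms(1) e0(1), of "\<lambda>e. cofactor A e j" "\<lambda>e. c e j"])
         (use e0(2) c \<open>j < k\<close> in auto)
    define A' where "A' = Matrix.mat k k (\<lambda>(e, r). if r = j then v e else A $$ (e, r))"
    have A': "A' \<in> carrier_mat k k"
      by (simp add: A'_def)
    \<comment> \<open>Only column \<open>j\<close> was replaced, and the minors along it delete that
      column.\<close>
    have "mat_delete A' e j = mat_delete A e j" if "e < k" for e
      using A(1) by (auto simp: mat_delete_def A'_def)
    then have "cofactor A' e j = cofactor A e j" if "e < k" for e
      using that by (simp add: cofactor_def)
    then have "Determinant.det A' = (\<Sum>e<k. v e * cofactor A e j)"
      by (subst laplace_expansion_column[OF A' \<open>j < k\<close>], intro sum.cong)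
         (use \<open>j < k\<close> in \<open>auto simp: A'_def\<close>)
    with v(4) have "Determinant.det A' \<noteq> 0"
      by simp
    moreover have "good A' r" if "r < Suc j" for r
    proof (cases "r = j")
      case True
      have "A' $$ (e, r) = v e" if "e < k" for e
        using that \<open>j < k\<close> True by (simp add: A'_def)
      then show ?thesis
        using v(1-3) True unfolding good_def by metis
    next
      case False
      have "A' $$ (e, r) = A $$ (e, r)" if "e < k" for e
        using that \<open>j < k\<close> False \<open>r < Suc j\<close> by (simp add: A'_def)
      moreover have "good A r"
        using cols False \<open>r < Suc j\<close> by simp
      ultimately show ?thesis
        unfolding good_def by metis
    qed
    ultimately show ?case
      using A' by blast
  qed
  then obtain A where A: "A \<in> carrier_mat k k" "Determinant.det A \<noteq> 0" "\<forall>r<k. good A r"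
    by blast
  show ?thesis
    by (rule that[OF A(1,2)]) (use A(3) in \<open>simp_all add: good_def\<close>)
qed

lemma sum_inverse_entries:
  fixes A :: "real mat"
  assumes A: "A \<in> carrier_mat k k" and det: "Determinant.det A \<noteq> 0"
  obtains P where
    "\<And>e e'. e < k \<Longrightarrow> e' < k \<Longrightarrow> (\<Sum>r<k. A $$ (e, r) * P r e') = (if e = e' then 1 else 0)"
    "\<And>r r'. r < k \<Longrightarrow> r' < k \<Longrightarrow> (\<Sum>e<k. P r e * A $$ (e, r')) = (if r = r' then 1 else 0)"
proof -
  note adj = adj_mat[OF A]
  define P where "P = (\<lambda>r e. adj_mat A $$ (r, e) / Determinant.det A)"
  have "(\<Sum>r<k. A $$ (e, r) * P r e') = (if e = e' then 1 else 0)" if "e < k" "e' < k" for e e'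
  proof -
    have "(\<Sum>r<k. A $$ (e, r) * P r e') = (A * adj_mat A) $$ (e, e') / Determinant.det A"
      using that A adj(1) by (auto simp: P_def scalar_prod_def sum_divide_distrib atLeast0LessThan)
    then show ?thesis
      using that det by (simp add: adj(2))
  qed
  moreover have "(\<Sum>e<k. P r e * A $$ (e, r')) = (if r = r' then 1 else 0)" if "r < k" "r' < k" for r r'
  proof -
    have "(\<Sum>e<k. P r e * A $$ (e, r')) = (adj_mat A * A) $$ (r, r') / Determinant.det A"
      using that A adj(1) by (auto simp: P_def scalar_prod_def sum_divide_distrib atLeast0LessThan)
    then show ?thesis
      using that det by (simp add: adj(3))
  qed
  ultimately show ?thesis
    using that by blast
qed

text \<open>
  For k = 2 a column may have only one choice of mixed signs up to a common factor, so this case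
  needs the constant column of c.
\<close>

lemma signed_matrix_without_parallel_column:
  fixes c :: "nat \<Rightarrow> nat \<Rightarrow> real" and \<omega> :: "nat \<Rightarrow> real"
  assumes "1 \<le> k" and c: "\<And>e r. e < k \<Longrightarrow> r < k \<Longrightarrow> c e r \<noteq> 0" and c0: "\<And>e. e < k \<Longrightarrow> c e 0 = 1"
    and pos: "\<And>e. e < k \<Longrightarrow> \<omega> e > 0" and inj: "inj_on \<omega> {..<k}"
  obtains A where "A \<in> carrier_mat k k" "Determinant.det A \<noteq> 0"
    "\<And>e r. e < k \<Longrightarrow> r < k \<Longrightarrow> \<bar>A $$ (e, r)\<bar> = \<bar>c e r\<bar>"
    "\<And>r b. 2 \<le> k \<Longrightarrow> r < k \<Longrightarrow> \<exists>e<k. A $$ (e, r) \<noteq> b * \<omega> e"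
proof -
  \<comment> \<open>A multiple of the positive vector \<open>\<omega>\<close> cannot have entries of
    both signs.\<close>
  have mixed: "\<exists>e<k. v e \<noteq> b * \<omega> e" if mixed_v: "\<exists>e<k. v e > 0" "\<exists>e<k. v e < 0" for v b
  proof (rule ccontr)
    assume "\<not> ?thesis"
    then have eq: "\<And>e. e < k \<Longrightarrow> v e = b * \<omega> e"
      by blast
    then have "b > 0" "b < 0"
      using mixed_v pos by (force simp: zero_less_mult_iff mult_less_0_iff)+
    then show False
      by simp
  qed
  consider "k = 1" | "k = 2" | "3 \<le> k"
    using assms(1) by linarith
  then show ?thesis
  proof cases
    \<comment> \<open>In dimension 1 every column is a multiple of \<open>\<omega>\<close>, hence
      the guard 2 \<le> k in the last conclusion.\<close>
    case 1
    then have "\<bar>1\<^sub>m 1 $$ (e, r)\<bar> = \<bar>c e r\<bar>" if "e < k" "r < k" for e r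
      using that c0 by simp
    with 1 show ?thesis
      by (intro that[of "1\<^sub>m 1"]) auto
  next
    case 2
    \<comment> \<open>One minus sign, in the last corner, makes both products in the determinant
      contribute negatively. Column 1 has mixed signs; column 0 is constant and relies on \<omega> 0
      \<noteq> \<omega> 1.\<close>
    define A where "A = Matrix.mat 2 2 (\<lambda>(e, r). if e = (1::nat) \<and> r = (1::nat) then - \<bar>c e r\<bar> else \<bar>c e r\<bar>)"
    have A: "A \<in> carrier_mat 2 2"
      by (simp add: A_def)
    have entries: "A $$ (0, 0) = 1" "A $$ (1, 0) = 1" "A $$ (0, 1) = \<bar>c 0 1\<bar>" "A $$ (1, 1) = - \<bar>c 1 1\<bar>"
      using c0 2 by (auto simp: A_def)
    have "Determinant.det A = A $$ (0, 0) * A $$ (1, 1) - A $$ (1, 0) * A $$ (0, 1)"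
      using laplace_expansion_column[OF A, of 0] A
      by (simp add: cofactor_def mat_delete_def det_single numeral_2_eq_2)
    then have "Determinant.det A = - \<bar>c 1 1\<bar> - \<bar>c 0 1\<bar>"
      by (simp only: entries mult_1_left)
    moreover have "c 1 1 \<noteq> 0" "c 0 1 \<noteq> 0"
      using c 2 by auto
    ultimately have "Determinant.det A \<noteq> 0"
      by simp
    moreover have "\<bar>A $$ (e, r)\<bar> = \<bar>c e r\<bar>" if "e < k" "r < k" for e r
      using that 2 by (auto simp: A_def)
    moreover have "\<exists>e<k. A $$ (e, r) \<noteq> b * \<omega> e" if "r < k" for r b
    proof (cases "r = 0")
      case True
      have "\<omega> 0 \<noteq> \<omega> 1"
        using inj_onD[OF inj, of 0 1] 2 by auto
      then have "\<not> (1 = b * \<omega> 0 \<and> 1 = b * \<omega> 1)"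
        by (metis mult_cancel_left mult_zero_left zero_neq_one)
      then show ?thesis
        using 2 entries True by (metis one_less_numeral_iff pos2 semiring_norm(76))
    next
      case False
      with that 2 have "r = 1"
        by simp
      then show ?thesis
        using 2 entries \<open>c 1 1 \<noteq> 0\<close> \<open>c 0 1 \<noteq> 0\<close>
        by (intro mixed) (auto intro: exI[of _ "0::nat"] exI[of _ "1::nat"])
    qed
    ultimately show ?thesis
      using that A 2 by blast
  next
    case 3
    obtain A where A: "A \<in> carrier_mat k k" "Determinant.det A \<noteq> 0"
      "\<And>e r. e < k \<Longrightarrow> r < k \<Longrightarrow> \<bar>A $$ (e, r)\<bar> = \<bar>c e r\<bar>"
      and signs: "\<And>r. r < k \<Longrightarrow> (\<exists>e<k. A $$ (e, r) > 0) \<and> (\<exists>e<k. A $$ (e, r) < 0)"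
      by (rule mixed_sign_matrix[OF 3, of c]) (use c in auto)
    show ?thesis
    proof (rule that[OF A])
      show "\<exists>e<k. A $$ (e, r) \<noteq> b * \<omega> e" if "r < k" for r b
        using signs[OF that] by (intro mixed) auto
    qed
  qed
qed

section \<open>Removing zero coefficients\<close>

text \<open>If every pair of nonzero terms cancelled, a third nonzero term would be opposite to both
  \<open>x r1\<close> and \<open>x r2\<close>, which are opposite to each other. So these two would
  be the only nonzero terms and the whole sum would vanish. The pair found here provides the two
  sides of a triangle with nonzero third side.\<close>

lemma exists_pair_nonzero_sum:
  fixes x :: "'a \<Rightarrow> real"
  assumes "finite I" "(\<Sum>r\<in>I. x r) \<noteq> 0"
    and r: "r1 \<in> I" "r2 \<in> I" "r1 \<noteq> r2" "x r1 \<noteq> 0" "x r2 \<noteq> 0"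
  shows "\<exists>r\<in>I. \<exists>r'\<in>I. r \<noteq> r' \<and> x r \<noteq> 0 \<and> x r' \<noteq> 0 \<and> x r + x r' \<noteq> 0"
proof (rule ccontr)
  assume none: "\<not> ?thesis"
  then have opposite: "x r1 + x r2 = 0"
    using r by blast
  have "x r = 0" if "r \<in> I - {r1, r2}" for r
  proof (rule ccontr)
    assume "x r \<noteq> 0"
    then have "x r + x r1 = 0" "x r + x r2 = 0"
      using none r that by blast+
    with opposite \<open>x r \<noteq> 0\<close> show False
      by linarith
  qed
  then have "(\<Sum>r\<in>I. x r) = (\<Sum>r\<in>{r1, r2}. x r)"
    using assms(1) r by (intro sum.mono_neutral_right) auto
  then show False
    using assms(2) opposite r(3) by simp
qed

text \<open>
  A triangle with side lengths p, q and the sum minus t d; the cosine x of the first angle is given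
  by the law of cosines. The sign condition on d makes x at most 1.
\<close>

lemma eventually_rotated_pair:
  fixes p q :: "real \<Rightarrow> real"
  assumes p: "(p \<longlongrightarrow> p0) (at_right 0)" and q: "(q \<longlongrightarrow> q0) (at_right 0)"
    and nz: "p0 \<noteq> 0" "q0 \<noteq> 0" "p0 + q0 \<noteq> 0" and d: "d * (p0 * q0 * (p0 + q0)) > 0" and "\<epsilon> > 0"
  shows "\<forall>\<^sub>F t in at_right 0. \<exists>u1 u2. cmod u1 = 1 \<and> cmod u2 = 1 \<and> cmod (u1 - 1) < \<epsilon> \<and> cmod (u2 - 1) < \<epsilon> \<and>
      of_real (p t) * u1 + of_real (q t) * u2 = of_real (p t + q t - t * d)"
proof -
  define s where "s = (\<lambda>t. p t + q t - t * d)"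
  define x where "x = (\<lambda>t. ((p t)\<^sup>2 + (s t)\<^sup>2 - (q t)\<^sup>2) / (2 * p t * s t))"
  define u1 where "u1 = (\<lambda>t. Complex (x t) (sqrt (1 - (x t)\<^sup>2)))"
  \<comment> \<open>\<open>u2\<close> is defined by the equation to be solved; that it has modulus 1
    is the law of cosines.\<close>
  define u2 where "u2 = (\<lambda>t. (of_real (s t) - of_real (p t) * u1 t) / of_real (q t))"
  have s: "(s \<longlongrightarrow> p0 + q0) (at_right 0)"
    unfolding s_def by (rule tendsto_eq_intros p q | simp)+
  have x: "(x \<longlongrightarrow> 1) (at_right 0)"
  proof -
    have "(x \<longlongrightarrow> (p0\<^sup>2 + (p0 + q0)\<^sup>2 - q0\<^sup>2) / (2 * p0 * (p0 + q0))) (at_right 0)"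
      unfolding x_def by (intro tendsto_intros p q s) (use nz in auto)
    moreover have "p0\<^sup>2 + (p0 + q0)\<^sup>2 - q0\<^sup>2 = 2 * p0 * (p0 + q0)"
      by (simp add: power2_eq_square algebra_simps)
    ultimately show ?thesis
      using nz by simp
  qed
  have u1: "(u1 \<longlongrightarrow> 1) (at_right 0)"
  proof -
    have "(u1 \<longlongrightarrow> Complex 1 (sqrt (1 - 1\<^sup>2))) (at_right 0)"
      unfolding u1_def by (intro tendsto_intros x)
    then show ?thesis
      by (simp add: one_complex.code)
  qed
  have u2: "(u2 \<longlongrightarrow> 1) (at_right 0)"
  proof -
    have "(u2 \<longlongrightarrow> (of_real (p0 + q0) - of_real p0 * 1) / of_real q0) (at_right 0)"
      unfolding u2_def by (intro tendsto_intros s p q u1) (use nz in auto)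
    then show ?thesis
      using nz by simp
  qed
  \<comment> \<open>This quotient is (1 - x t) / t. Its limit d q0 / (p0 (p0 + q0)) has the sign of
    d p0 q0 (p0 + q0), so the hypothesis on \<open>d\<close> yields x t < 1 for small t > 0.\<close>
  have "((\<lambda>t. d * (2 * q t - t * d) / (2 * p t * s t)) \<longlongrightarrow> d * (2 * q0 - 0 * d) / (2 * p0 * (p0 + q0))) (at_right 0)"
    by (intro tendsto_intros s p q) (use nz in auto)
  moreover have "d * (2 * q0 - 0 * d) / (2 * p0 * (p0 + q0)) > 0"
  proof -
    have "0 < (d * q0) * (p0 * (p0 + q0))"
      using d by (simp only: mult_ac)
    then have "0 < (d * q0) / (p0 * (p0 + q0))"
      by (simp only: zero_less_divide_iff zero_less_mult_iff)
    then have "0 < (2 * (d * q0)) / (2 * (p0 * (p0 + q0)))"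
      by (simp only: mult_divide_mult_cancel_left_if) simp
    then show ?thesis
      by (simp only: mult_ac mult_zero_left diff_0_right)
  qed
  ultimately have sign: "\<forall>\<^sub>F t in at_right 0. d * (2 * q t - t * d) / (2 * p t * s t) > 0"
    using order_tendstoD(1) by blast
  have ev: "\<forall>\<^sub>F t in at_right 0. p t \<noteq> 0" "\<forall>\<^sub>F t in at_right 0. q t \<noteq> 0" "\<forall>\<^sub>F t in at_right 0. s t \<noteq> 0"
    using p q s nz tendsto_imp_eventually_ne by blast+
  have "\<forall>\<^sub>F t in at_right 0. x t > - 1"
    using x order_tendstoD(1) by fastforce
  moreover have "\<forall>\<^sub>F t in at_right 0. cmod (u1 t - 1) < \<epsilon>" "\<forall>\<^sub>F t in at_right 0. cmod (u2 t - 1) < \<epsilon>"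
    using u1 u2 \<open>\<epsilon> > 0\<close> by (auto simp: tendsto_iff dist_norm)
  moreover have "\<forall>\<^sub>F t in at_right (0::real). t > 0"
    by (simp add: eventually_at_right_less)
  ultimately show ?thesis
    using sign ev
  proof eventually_elim
    case (elim t)
    have "1 - x t = t * (d * (2 * q t - t * d) / (2 * p t * s t))"
    proof -
      have "t * (d * (2 * q t - t * d)) = 2 * p t * s t - ((p t)\<^sup>2 + (s t)\<^sup>2 - (q t)\<^sup>2)"
        by (simp add: s_def power2_eq_square algebra_simps)
      moreover have "2 * p t * s t / (2 * p t * s t) = 1"
        using elim by simp
      ultimately show ?thesis
        by (simp only: times_divide_eq_right diff_divide_distrib x_def)
    qed
    moreover have "t * (d * (2 * q t - t * d) / (2 * p t * s t)) > 0"
      using elim by (intro mult_pos_pos) auto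
    ultimately have "\<bar>x t\<bar> \<le> 1"
      using elim(1) by linarith
    then have x2: "(x t)\<^sup>2 \<le> 1"
      by (simp add: abs_square_le_1)
    then have n1: "cmod (u1 t) = 1"
      by (simp add: u1_def cmod_def)
    have "(cmod (of_real (s t) - of_real (p t) * u1 t))\<^sup>2 = (s t - p t * x t)\<^sup>2 + (p t)\<^sup>2 * (1 - (x t)\<^sup>2)"
      using x2 by (simp add: u1_def cmod_power2 power_mult_distrib)
    also have "\<dots> = (s t)\<^sup>2 + (p t)\<^sup>2 - 2 * p t * s t * x t"
      by (simp add: power2_eq_square algebra_simps)
    also have "\<dots> = (q t)\<^sup>2"
      using elim by (simp add: x_def)
    finally have "cmod (of_real (s t) - of_real (p t) * u1 t) = \<bar>q t\<bar>"
      by (metis norm_ge_zero power2_eq_iff_nonneg abs_ge_zero power2_abs)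
    then have n2: "cmod (u2 t) = 1"
      using elim by (simp add: u2_def norm_divide)
    have "of_real (p t) * u1 t + of_real (q t) * u2 t = of_real (s t)"
      using elim by (simp add: u2_def)
    with n1 n2 elim show ?case
      unfolding s_def by blast
  qed
qed

text \<open>Moving \<open>a\<close> by t b changes the row sum by t d, where d is the row sum of
  \<open>b\<close>. Rotating the two terms \<open>r1\<close> and \<open>r2\<close> lowers their
  joint contribution by exactly t d, and all other terms keep the phase 1.\<close>

lemma eventually_rotated_row:
  fixes M a b :: "nat \<Rightarrow> real"
  assumes r: "r1 < k" "r2 < k" "r1 \<noteq> r2"
    and nz: "M r1 * a r1 \<noteq> 0" "M r2 * a r2 \<noteq> 0" "M r1 * a r1 + M r2 * a r2 \<noteq> 0"
    and d: "(\<Sum>r<k. M r * b r) * ((M r1 * a r1) * (M r2 * a r2) * (M r1 * a r1 + M r2 * a r2)) > 0"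
    and "\<epsilon> > 0"
  shows "\<forall>\<^sub>F t in at_right 0. \<exists>u. (\<forall>r. cmod (u r) = 1 \<and> cmod (u r - 1) < \<epsilon>) \<and>
      (\<Sum>r<k. of_real (M r) * u r * of_real (a r + t * b r)) = of_real (\<Sum>r<k. M r * a r)"
proof -
  define p where "p = (\<lambda>t. M r1 * (a r1 + t * b r1))"
  define q where "q = (\<lambda>t. M r2 * (a r2 + t * b r2))"
  define d' where "d' = (\<Sum>r<k. M r * b r)"
  have "(p \<longlongrightarrow> M r1 * (a r1 + 0 * b r1)) (at_right 0)" "(q \<longlongrightarrow> M r2 * (a r2 + 0 * b r2)) (at_right 0)"
    unfolding p_def q_def by (intro tendsto_intros)+
  then have pq: "(p \<longlongrightarrow> M r1 * a r1) (at_right 0)" "(q \<longlongrightarrow> M r2 * a r2) (at_right 0)"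
    by simp_all
  show ?thesis
    using eventually_rotated_pair[OF pq nz d \<open>\<epsilon> > 0\<close>]
  proof eventually_elim
    case (elim t)
    then obtain u1 u2 where u: "cmod u1 = 1" "cmod u2 = 1" "cmod (u1 - 1) < \<epsilon>" "cmod (u2 - 1) < \<epsilon>"
      and eq: "of_real (p t) * u1 + of_real (q t) * u2 = of_real (p t + q t - t * d')"
      by (auto simp: d'_def)
    define u where "u = (\<lambda>r. if r = r1 then u1 else if r = r2 then u2 else 1)"
    define f where "f = (\<lambda>r. complex_of_real (M r) * u r * of_real (a r + t * b r))"
    define g where "g = (\<lambda>r. M r * (a r + t * b r))"
    have split: "(\<Sum>r<k. h r) = h r1 + h r2 + (\<Sum>r\<in>{..<k} - {r1, r2}. h r)" for h :: "nat \<Rightarrow> complex"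
      using r by (subst sum.subset_diff[of "{r1, r2}"]) auto
    have "(\<Sum>r<k. f r) = of_real (p t) * u1 + of_real (q t) * u2 + (\<Sum>r\<in>{..<k} - {r1, r2}. of_real (g r))"
      unfolding split[of f] using r
      by (intro arg_cong2[of _ _ _ _ "(+)"] sum.cong) (auto simp: f_def g_def u_def p_def q_def)
    also have "\<dots> = (\<Sum>r<k. of_real (g r)) - of_real (t * d')"
      unfolding split[of "\<lambda>r. of_real (g r)"] eq by (simp add: g_def p_def q_def)
    also have "\<dots> = of_real (\<Sum>r<k. M r * a r)"
      by (simp add: g_def d'_def distrib_left sum.distrib sum_distrib_left mult.left_commute)
    finally have "(\<Sum>r<k. f r) = of_real (\<Sum>r<k. M r * a r)" .
    then show ?case
      using u \<open>\<epsilon> > 0\<close> by (intro exI[of _ u]) (auto simp: u_def f_def)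
  qed
qed

text \<open>
  The solution a of M a = w may have zero entries, and then the delays belonging to them would have
  no effect to first order. Moving a in a suitable direction b and rotating two entries of
  each row of M by small angles removes the zeros.
\<close>

lemma unimodular_perturbation:
  fixes M P :: "nat \<Rightarrow> nat \<Rightarrow> real" and \<omega> :: "nat \<Rightarrow> real"
  assumes MP: "\<And>e e'. e < k \<Longrightarrow> e' < k \<Longrightarrow> (\<Sum>r<k. M e r * P r e') = (if e = e' then 1 else 0)"
    and nz: "\<And>e r. e < k \<Longrightarrow> r < k \<Longrightarrow> M e r \<noteq> 0"
    and "1 \<le> k" and pos: "\<And>e. e < k \<Longrightarrow> \<omega> e > 0"
    and par: "\<And>r b. 2 \<le> k \<Longrightarrow> r < k \<Longrightarrow> \<exists>e<k. M e r \<noteq> b * \<omega> e" and "\<epsilon> > 0"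
  obtains a u where "\<And>r. r < k \<Longrightarrow> a r \<noteq> 0"
    "\<And>e r. e < k \<Longrightarrow> r < k \<Longrightarrow> cmod (u e r) = 1 \<and> cmod (u e r - 1) < \<epsilon>"
    "\<And>e. e < k \<Longrightarrow> (\<Sum>r<k. of_real (M e r) * u e r * of_real (a r)) = of_real (\<omega> e)"
proof -
  have inv: "(\<Sum>r<k. M e r * (\<Sum>e'<k. P r e' * w e')) = w e" if e: "e < k" for e and w :: "nat \<Rightarrow> real"
  proof -
    have "(\<Sum>r<k. M e r * (\<Sum>e'<k. P r e' * w e')) = (\<Sum>e'<k. (\<Sum>r<k. M e r * P r e') * w e')"
      unfolding sum_distrib_left sum_distrib_right by (subst sum.swap) (simp add: mult.assoc)
    also have "\<dots> = (\<Sum>e'<k. if e = e' then w e' else 0)"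
      by (intro sum.cong) (use e in \<open>auto simp: MP\<close>)
    finally show ?thesis
      using e by simp
  qed
  define a where "a = (\<lambda>r. \<Sum>e<k. P r e * \<omega> e)"
  have a: "(\<Sum>r<k. M e r * a r) = \<omega> e" if "e < k" for e
    unfolding a_def by (rule inv[OF that])
  have "\<exists>r1<k. a r1 \<noteq> 0"
  proof (rule ccontr)
    assume "\<not> ?thesis"
    then have "(\<Sum>r<k. M 0 r * a r) = 0"
      by (intro sum.neutral) auto
    with a[of 0] pos[of 0] \<open>1 \<le> k\<close> show False
      by simp
  qed
  then obtain r1 where r1: "r1 < k" "a r1 \<noteq> 0"
    by blast
  show ?thesis
  proof (cases "k = 1")
    case True
    then show ?thesis
      using a[of 0] r1 \<open>\<epsilon> > 0\<close>
      by (intro that[of a "\<lambda>_ _. 1"]) (auto simp flip: of_real_mult)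
  next
    case False
    then have "2 \<le> k"
      using \<open>1 \<le> k\<close> by simp
    \<comment> \<open>With \<open>a r1\<close> as the only nonzero entry, column \<open>r1\<close>
      would be \<omega> / a r1, which \<open>par\<close> excludes.\<close>
    have "\<exists>r2<k. r2 \<noteq> r1 \<and> a r2 \<noteq> 0"
    proof (rule ccontr)
      assume zero: "\<not> ?thesis"
      have "M e r1 = 1 / a r1 * \<omega> e" if "e < k" for e
      proof -
        have "(\<Sum>r<k. M e r * a r) = (\<Sum>r\<in>{r1}. M e r * a r)"
          using r1 zero by (intro sum.mono_neutral_right) auto
        with a[OF that] r1 show ?thesis
          by (simp add: field_simps)
      qed
      with par[OF \<open>2 \<le> k\<close> r1(1), of "1 / a r1"] show False
        by blast
    qed
    then obtain r2 where r2: "r2 < k" "r2 \<noteq> r1" "a r2 \<noteq> 0"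
      by blast
    have "\<exists>r\<in>{..<k}. \<exists>r'\<in>{..<k}. r \<noteq> r' \<and> M e r * a r \<noteq> 0 \<and> M e r' * a r' \<noteq> 0 \<and>
        M e r * a r + M e r' * a r' \<noteq> 0" if "e < k" for e
      using r1 r2 nz[OF that] a[OF that] pos[OF that]
      by (intro exists_pair_nonzero_sum[of _ _ r1 r2]) auto
    then obtain f g where fg: "\<And>e. e < k \<Longrightarrow> f e < k \<and> g e < k \<and> f e \<noteq> g e \<and> M e (f e) * a (f e) \<noteq> 0 \<and>
        M e (g e) * a (g e) \<noteq> 0 \<and> M e (f e) * a (f e) + M e (g e) * a (g e) \<noteq> 0"
      by (metis lessThan_iff)
    \<comment> \<open>Row e can be rotated if its row sum for \<open>b\<close> has the sign of
      \<open>S e\<close>. The choice b0 = P S makes that row sum equal to \<open>S e\<close>, so the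
      product is a positive square.\<close>
    define S where "S = (\<lambda>e. (M e (f e) * a (f e)) * (M e (g e) * a (g e)) *
        (M e (f e) * a (f e) + M e (g e) * a (g e)))"
    have S: "S e \<noteq> 0" if "e < k" for e
      using fg[OF that] by (simp add: S_def)
    define b0 where "b0 = (\<lambda>r. \<Sum>e<k. P r e * S e)"
    \<comment> \<open>Adding one small constant to all entries of \<open>b0\<close> makes them
      nonzero and keeps the strict sign conditions. A nonzero \<open>b r\<close> ensures that a r +
      t b r vanishes for at most one t.\<close>
    have ev_h: "\<forall>\<^sub>F h in at_right 0. (\<forall>e\<in>{..<k}. (\<Sum>r<k. M e r * (b0 r + h)) * S e > 0) \<and>
        (\<forall>r\<in>{..<k}. b0 r + h \<noteq> 0)"
    proof (intro eventually_conj eventually_ball_finite ballI)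
      fix e assume e: "e \<in> {..<k}"
      have "((\<lambda>h. (\<Sum>r<k. M e r * (b0 r + h)) * S e) \<longlongrightarrow> (\<Sum>r<k. M e r * (b0 r + 0)) * S e) (at_right 0)"
        by (intro tendsto_intros)
      moreover have "(\<Sum>r<k. M e r * (b0 r + 0)) * S e > 0"
        using e S[of e] inv[of e S] by (simp add: b0_def zero_less_mult_iff linorder_neq_iff disj_commute)
      ultimately show "\<forall>\<^sub>F h in at_right 0. (\<Sum>r<k. M e r * (b0 r + h)) * S e > 0"
        using order_tendstoD(1) by blast
    next
      fix r
      show "\<forall>\<^sub>F h in at_right 0. b0 r + h \<noteq> 0"
        using eventually_neq_at_within[of "- b0 r" "0" "{0<..}"]
        by eventually_elim auto
    qed auto
    obtain h where h: "\<And>e. e < k \<Longrightarrow> (\<Sum>r<k. M e r * (b0 r + h)) * S e > 0"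
      "\<And>r. r < k \<Longrightarrow> b0 r + h \<noteq> 0"
      using eventually_happens[OF ev_h] by auto
    define b where "b = (\<lambda>r. b0 r + h)"
    define good where "good = (\<lambda>t e u. (\<forall>r. cmod (u r) = 1 \<and> cmod (u r - 1) < \<epsilon>) \<and>
        (\<Sum>r<k. of_real (M e r) * u r * of_real (a r + t * b r)) = of_real (\<Sum>r<k. M e r * a r))"
    have ev_t: "\<forall>\<^sub>F t in at_right 0. (\<forall>e\<in>{..<k}. \<exists>u. good t e u) \<and>
        (\<forall>r\<in>{..<k}. a r + t * b r \<noteq> 0)"
    proof (intro eventually_conj eventually_ball_finite ballI)
      fix e assume e: "e \<in> {..<k}"
      show "\<forall>\<^sub>F t in at_right 0. \<exists>u. good t e u"
        unfolding good_def using fg[of e] h(1)[of e] e \<open>\<epsilon> > 0\<close>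
        by (intro eventually_rotated_row[of "f e" _ "g e"]) (auto simp: b_def S_def)
    next
      fix r assume r: "r \<in> {..<k}"
      show "\<forall>\<^sub>F t in at_right 0. a r + t * b r \<noteq> 0"
      proof -
        have "\<forall>\<^sub>F t in at_right 0. t \<noteq> - (a r / b r)"
          by (rule eventually_neq_at_within)
        then show ?thesis
          by (rule eventually_mono) (use h(2)[of r] r in \<open>auto simp: b_def field_simps add_eq_0_iff\<close>)
      qed
    qed auto
    obtain t where t: "\<And>e. e < k \<Longrightarrow> \<exists>u. good t e u"
      "\<And>r. r < k \<Longrightarrow> a r + t * b r \<noteq> 0"
      using eventually_happens[OF ev_t] by auto
    from t(1) obtain u where "\<And>e. e < k \<Longrightarrow> good t e (u e)"
      by metis
    then show ?thesis
      using t(2) a by (intro that[of "\<lambda>r. a r + t * b r" u]) (auto simp: good_def simp del: of_real_sum of_real_mult of_real_add)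
  qed
qed

section \<open>Solving for delays and coefficients\<close>

text \<open>The derivative i \<kappa> (1 - exp (- i \<kappa> z)) of the remainder has modulus at
  most \<kappa>^2 \<rho> on the real segment from - \<rho> to \<rho>, so the Lipschitz constant
  shrinks with the radius.\<close>

lemma exp_remainder_lipschitz:
  fixes \<kappa> s s' \<rho> :: real
  assumes "\<bar>s\<bar> \<le> \<rho>" "\<bar>s'\<bar> \<le> \<rho>"
  shows "cmod ((exp (- (\<i> * of_real (\<kappa> * s))) + \<i> * of_real (\<kappa> * s)) -
      (exp (- (\<i> * of_real (\<kappa> * s'))) + \<i> * of_real (\<kappa> * s'))) \<le> \<kappa>\<^sup>2 * \<rho> * \<bar>s - s'\<bar>"
proof -
  define S where "S = closed_segment (complex_of_real (- \<rho>)) (complex_of_real \<rho>)"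
  define f where "f = (\<lambda>z. exp (- (\<i> * of_real \<kappa> * z)) + \<i> * of_real \<kappa> * z)"
  define f' where "f' = (\<lambda>z. \<i> * of_real \<kappa> * (1 - exp (- (\<i> * of_real \<kappa> * z))))"
  have "\<rho> \<ge> 0"
    using assms by linarith
  then have S: "S = of_real ` {- \<rho>..\<rho>}"
    unfolding S_def closed_segment_of_real by (simp add: closed_segment_eq_real_ivl)
  have "cmod (f (of_real s) - f (of_real s')) \<le> \<kappa>\<^sup>2 * \<rho> * cmod (of_real s - of_real s')"
  proof (rule field_differentiable_bound[where S = S and f' = f'])
    show "convex S"
      by (simp add: S_def)
    show "(f has_field_derivative f' z) (at z within S)" for z
      unfolding f_def f'_def by (auto intro!: derivative_eq_intros simp: algebra_simps)
    show "of_real s \<in> S" "of_real s' \<in> S"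
      using assms by (auto simp: S intro!: imageI)
    show "cmod (f' z) \<le> \<kappa>\<^sup>2 * \<rho>" if "z \<in> S" for z
    proof -
      obtain x where x: "z = of_real x" "\<bar>x\<bar> \<le> \<rho>"
        using \<open>z \<in> S\<close> by (auto simp: S)
      have "cmod (1 - exp (- (\<i> * of_real \<kappa> * z))) = cmod (exp (\<i> * of_real (- (\<kappa> * x))) - 1)"
        by (simp add: x(1) norm_minus_commute mult.assoc)
      also have "\<dots> = 2 * \<bar>sin (- (\<kappa> * x) / 2)\<bar>"
        by (rule dist_exp_i_1)
      also have "\<dots> \<le> \<bar>\<kappa>\<bar> * \<bar>x\<bar>"
        using abs_sin_x_le_abs_x[of "- (\<kappa> * x) / 2"] by (simp add: abs_mult)
      also have "\<dots> \<le> \<bar>\<kappa>\<bar> * \<rho>"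
        using x(2) by (intro mult_left_mono) auto
      finally have "cmod (f' z) \<le> \<bar>\<kappa>\<bar> * (\<bar>\<kappa>\<bar> * \<rho>)"
        unfolding f'_def by (simp add: norm_mult mult_left_mono)
      then show ?thesis
        by (simp add: power2_eq_square mult.assoc flip: abs_mult)
    qed
  qed
  then show ?thesis
    by (simp add: f_def mult.assoc flip: of_real_diff)
qed

text \<open>Dividing the shift by \<open>a\<close> cancels the amplitude: the derivative of
  \<open>h\<close> at 0 is Im z - i \<omega> Re z, whatever \<open>a\<close> is.\<close>

lemma phase_amplitude_lipschitz:
  fixes a \<omega> :: real
  assumes "a \<noteq> 0" "0 \<le> \<rho>" "\<rho> \<le> 1" and z: "cmod z \<le> \<rho>" "cmod z' \<le> \<rho>"
  defines "h \<equiv> \<lambda>z. of_real (a + Im z) * exp (- (\<i> * of_real (\<omega> / a * Re z)))"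
  shows "cmod (h z - h z' - (of_real (Im (z - z')) - \<i> * of_real (\<omega> * Re (z - z'))))
    \<le> (2 * \<bar>\<omega> / a\<bar> + (\<bar>a\<bar> + 1) * (\<omega> / a)\<^sup>2) * \<rho> * cmod (z - z')"
proof -
  define \<kappa> where "\<kappa> = \<omega> / a"
  define g where "g = (\<lambda>z. exp (- (\<i> * of_real (\<kappa> * Re z))))"
  define D where "D = cmod (z - z')"
  have \<omega>: "\<omega> = \<kappa> * a"
    using \<open>a \<noteq> 0\<close> by (simp add: \<kappa>_def)
  have D: "\<bar>Im z - Im z'\<bar> \<le> D" "\<bar>Re z - Re z'\<bar> \<le> D" "0 \<le> D"
    using abs_Im_le_cmod[of "z - z'"] abs_Re_le_cmod[of "z - z'"] by (auto simp: D_def)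
  have re: "\<bar>Re z\<bar> \<le> \<rho>" "\<bar>Re z'\<bar> \<le> \<rho>" "\<bar>Im z'\<bar> \<le> \<rho>"
    using z abs_Re_le_cmod[of z] abs_Re_le_cmod[of z'] abs_Im_le_cmod[of z'] by auto
  \<comment> \<open>Amplitude change times phase deviation, amplitude times exponential remainder,
    and a correction for using a + Im z' in place of \<open>a\<close> in the linear term.\<close>
  have eq: "h z - h z' - (of_real (Im (z - z')) - \<i> * of_real (\<omega> * Re (z - z'))) =
      of_real (Im z - Im z') * (g z - 1)
      + of_real (a + Im z') * ((g z + \<i> * of_real (\<kappa> * Re z)) - (g z' + \<i> * of_real (\<kappa> * Re z')))
      + - (\<i> * of_real (\<kappa> * Im z' * (Re z - Re z')))"
    unfolding h_def g_def \<omega> using \<open>a \<noteq> 0\<close> by (simp add: algebra_simps)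
  have "cmod (g z - 1) = cmod (exp (\<i> * of_real (- (\<kappa> * Re z))) - 1)"
    by (simp add: g_def)
  also have "\<dots> = 2 * \<bar>sin (- (\<kappa> * Re z) / 2)\<bar>"
    by (rule dist_exp_i_1)
  also have "\<dots> \<le> \<bar>\<kappa>\<bar> * \<bar>Re z\<bar>"
    using abs_sin_x_le_abs_x[of "- (\<kappa> * Re z) / 2"] by (simp add: abs_mult)
  also have "\<dots> \<le> \<bar>\<kappa>\<bar> * \<rho>"
    using re by (intro mult_left_mono) auto
  finally have "cmod (of_real (Im z - Im z') * (g z - 1)) \<le> D * (\<bar>\<kappa>\<bar> * \<rho>)"
    unfolding norm_mult norm_of_real using D by (intro mult_mono) auto
  moreover have "cmod (of_real (a + Im z') * ((g z + \<i> * of_real (\<kappa> * Re z)) - (g z' + \<i> * of_real (\<kappa> * Re z'))))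
      \<le> (\<bar>a\<bar> + 1) * (\<kappa>\<^sup>2 * \<rho> * D)"
    unfolding norm_mult norm_of_real
  proof (rule mult_mono)
    show "\<bar>a + Im z'\<bar> \<le> \<bar>a\<bar> + 1"
      using re \<open>\<rho> \<le> 1\<close> by linarith
    have "cmod ((g z + \<i> * of_real (\<kappa> * Re z)) - (g z' + \<i> * of_real (\<kappa> * Re z')))
        \<le> \<kappa>\<^sup>2 * \<rho> * \<bar>Re z - Re z'\<bar>"
      unfolding g_def by (rule exp_remainder_lipschitz) (use re in auto)
    also have "\<dots> \<le> \<kappa>\<^sup>2 * \<rho> * D"
      using D \<open>0 \<le> \<rho>\<close> by (intro mult_left_mono) auto
    finally show "cmod ((g z + \<i> * of_real (\<kappa> * Re z)) - (g z' + \<i> * of_real (\<kappa> * Re z'))) \<le> \<kappa>\<^sup>2 * \<rho> * D" .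
  qed auto
  moreover have "cmod (- (\<i> * of_real (\<kappa> * Im z' * (Re z - Re z')))) \<le> \<bar>\<kappa>\<bar> * \<rho> * D"
    using re D \<open>0 \<le> \<rho>\<close> by (simp only: norm_minus_cancel norm_mult norm_ii norm_of_real abs_mult mult_1_left)
      (intro mult_mono, auto)
  ultimately have "cmod (h z - h z' - (of_real (Im (z - z')) - \<i> * of_real (\<omega> * Re (z - z'))))
      \<le> D * (\<bar>\<kappa>\<bar> * \<rho>) + (\<bar>a\<bar> + 1) * (\<kappa>\<^sup>2 * \<rho> * D) + \<bar>\<kappa>\<bar> * \<rho> * D"
    unfolding eq by (intro order.trans[OF norm_triangle_ineq] add_mono) auto
  also have "\<dots> = (2 * \<bar>\<kappa>\<bar> + (\<bar>a\<bar> + 1) * \<kappa>\<^sup>2) * \<rho> * D"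
    by (simp add: algebra_simps)
  finally show ?thesis
    by (simp only: \<kappa>_def D_def)
qed

lemma eventually_at_right_mult_less:
  fixes b d :: real
  assumes "d > 0"
  shows "\<forall>\<^sub>F x in at_right 0. b * x < d"
proof -
  have "((\<lambda>x. b * x) \<longlongrightarrow> b * 0) (at_right 0)"
    by (intro tendsto_intros)
  then show ?thesis
    using order_tendstoD(2)[of "\<lambda>x. b * x" 0 "at_right 0" d] assms by simp
qed

text \<open>
  The unknown z r = s + i b stands for the delay shift s / a r and the coefficient change b.
  After dividing the real part of row e by the frequency, the derivative at the base
  point is close to the real matrix M, so that its inverse P serves in the Newton iteration.
\<close>

lemma prescribed_imaginary_roots:
  fixes c :: "nat \<Rightarrow> nat \<Rightarrow> real" and \<omega> :: "nat \<Rightarrow> real"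
  assumes "1 \<le> k" and c: "\<And>e r. e < k \<Longrightarrow> r < k \<Longrightarrow> c e r \<noteq> 0" and c0: "\<And>e. e < k \<Longrightarrow> c e 0 = 1"
    and pos: "\<And>e. e < k \<Longrightarrow> \<omega> e > 0" and indep: "rat_independent_family \<omega> {..<k}"
  obtains \<tau> a where "\<And>r. r < k \<Longrightarrow> \<tau> r > 0"
    "\<And>e. e < k \<Longrightarrow> (\<Sum>r<k. of_real (c e r * a r) * exp (- (\<i> * of_real (\<omega> e)) * of_real (\<tau> r))) = \<i> * of_real (\<omega> e)"
proof -
  have inj: "inj_on \<omega> {..<k}"
    using indep by (simp add: rat_independent_family_def)
  obtain A where A: "A \<in> carrier_mat k k" "Determinant.det A \<noteq> 0"
    and abs_A: "\<And>e r. e < k \<Longrightarrow> r < k \<Longrightarrow> \<bar>A $$ (e, r)\<bar> = \<bar>c e r\<bar>"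
    and par: "\<And>r b. 2 \<le> k \<Longrightarrow> r < k \<Longrightarrow> \<exists>e<k. A $$ (e, r) \<noteq> b * \<omega> e"
    using signed_matrix_without_parallel_column[where c = c and \<omega> = \<omega>, OF \<open>1 \<le> k\<close> c c0 pos inj] by metis
  define M where "M = (\<lambda>e r. A $$ (e, r))"
  obtain P where
    MP: "\<And>e e'. e < k \<Longrightarrow> e' < k \<Longrightarrow> (\<Sum>r<k. M e r * P r e') = (if e = e' then 1 else 0)" and
    PM: "\<And>r r'. r < k \<Longrightarrow> r' < k \<Longrightarrow> (\<Sum>e<k. P r e * M e r') = (if r = r' then 1 else 0)"
    using sum_inverse_entries[OF A] unfolding M_def by blast
  have abs_M: "\<bar>M e r\<bar> = \<bar>c e r\<bar>" and M_nz: "M e r \<noteq> 0" if "e < k" "r < k" for e r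
    using abs_A[OF that] c[OF that] by (auto simp: M_def)
  have par_M: "\<exists>e<k. M e r \<noteq> b * \<omega> e" if "2 \<le> k" "r < k" for r b
    using par[OF that] by (simp add: M_def)
  define K where "K = (\<Sum>r<k. \<Sum>e<k. \<bar>P r e\<bar>)"
  define C where "C = (\<Sum>e<k. \<Sum>r<k. \<bar>c e r\<bar>)"
  define R where "R = 1 + (\<Sum>e<k. 1 / \<omega> e)"
  define W where "W = 1 + (\<Sum>e<k. \<omega> e)"
  have "K \<ge> 0" "C \<ge> 0"
    by (auto simp: K_def C_def intro!: sum_nonneg)
  have "R > 0" "W > 0"
    using pos by (auto simp: R_def W_def less_imp_le intro!: add_pos_nonneg sum_nonneg)
  have C_ge: "\<bar>c e r\<bar> \<le> C" if "e < k" "r < k" for e r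
    unfolding C_def using that
    by (intro order.trans[OF member_le_sum[of r _ "\<lambda>r. \<bar>c e r\<bar>"] member_le_sum[of e _ "\<lambda>e. \<Sum>r<k. \<bar>c e r\<bar>"]])
       (auto intro!: sum_nonneg)
  have R_ge: "1 + 1 / \<omega> e \<le> R" if "e < k" for e
    unfolding R_def using that pos
    by (intro add_left_mono member_le_sum[of e _ "\<lambda>e. 1 / \<omega> e"]) (auto simp: less_imp_le)
  have W_ge: "1 + \<omega> e \<le> W" if "e < k" for e
    unfolding W_def using that pos
    by (intro add_left_mono member_le_sum[of e _ \<omega>]) (auto simp: less_imp_le)
  \<comment> \<open>The admissible Lipschitz error of the Newton map: \<open>K\<close> bounds the
    inverse \<open>P\<close>, and the contraction factor may be at most 1/2.\<close>
  define \<epsilon> where "\<epsilon> = 1 / (2 * (K + 1))"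
  have "\<epsilon> > 0" and K_\<epsilon>: "K * \<epsilon> \<le> 1 / 2"
    using \<open>K \<ge> 0\<close> by (auto simp: \<epsilon>_def field_simps)

  \<comment> \<open>Half of \<open>\<epsilon>\<close> pays for the distance of the base phases from
    i M / c and half for the nonlinear remainder. \<open>\<eta>1\<close> must precede
    \<open>a\<close>, since \<open>a\<close> comes from the perturbation of size
    \<open>\<eta>1\<close>; \<open>\<rho>\<close> and then \<open>\<eta>\<close> may depend on
    \<open>a\<close>.\<close>
  have ev_\<eta>1: "\<forall>\<^sub>F \<eta> in at_right 0. 0 < \<eta> \<and> (R * C * 2 * W) * \<eta> < \<epsilon> / 2"
    using \<open>\<epsilon> > 0\<close> by (intro eventually_conj eventually_at_right_mult_less eventually_at_right_less) auto
  obtain \<eta>1 where \<eta>1: "\<eta>1 > 0" "(R * C * 2 * W) * \<eta>1 < \<epsilon> / 2"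
    using eventually_happens[OF ev_\<eta>1] by auto
  obtain a u where a: "\<And>r. r < k \<Longrightarrow> a r \<noteq> 0"
    and u: "\<And>e r. e < k \<Longrightarrow> r < k \<Longrightarrow> cmod (u e r) = 1 \<and> cmod (u e r - 1) < \<eta>1"
    and Mu: "\<And>e. e < k \<Longrightarrow> (\<Sum>r<k. of_real (M e r) * u e r * of_real (a r)) = of_real (\<omega> e)"
    using unimodular_perturbation[where M = M and P = P and \<omega> = \<omega>, OF MP M_nz \<open>1 \<le> k\<close> pos par_M \<eta>1(1)] by blast

  define L where "L = (\<lambda>e r. 2 * \<bar>\<omega> e / a r\<bar> + (\<bar>a r\<bar> + 1) * (\<omega> e / a r)\<^sup>2)"
  have ev_\<rho>: "\<forall>\<^sub>F \<rho> in at_right 0. 0 < \<rho> \<and> 1 * \<rho> < 1 \<and> (\<forall>e\<in>{..<k}. \<forall>r\<in>{..<k}. (R * C * L e r) * \<rho> < \<epsilon> / 2)"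
    using \<open>\<epsilon> > 0\<close>
    by (intro eventually_conj eventually_ball_finite ballI eventually_at_right_mult_less eventually_at_right_less) auto
  obtain \<rho> where \<rho>: "0 < \<rho>" "\<rho> \<le> 1" "\<And>e r. e < k \<Longrightarrow> r < k \<Longrightarrow> (R * C * L e r) * \<rho> < \<epsilon> / 2"
    using eventually_happens[OF ev_\<rho>] by auto

  define S where "S = (\<Sum>r<k. \<bar>a r\<bar>)"
  have "S \<ge> 0"
    by (auto simp: S_def intro!: sum_nonneg)
  have ev_\<eta>: "\<forall>\<^sub>F \<eta> in at_right 0. 0 < \<eta> \<and> 1 * \<eta> < \<eta>1 \<and> (K * R * C * S) * \<eta> < \<rho> / 2"
    using \<eta>1 \<rho> by (intro eventually_conj eventually_at_right_mult_less eventually_at_right_less) auto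
  obtain \<eta> where \<eta>: "0 < \<eta>" "\<eta> \<le> \<eta>1" "(K * R * C * S) * \<eta> \<le> \<rho> / 2"
    using eventually_happens[OF ev_\<eta>] by auto

  \<comment> \<open>The quotient M e r / c e r is 1 or -1, so the target lies on the unit circle.
    Beyond \<rho> / \<bar>a r\<bar> the delay stays positive after the Newton shift.\<close>
  have "\<exists>t. t > \<rho> / \<bar>a r\<bar> \<and> (\<forall>e<k. cmod (exp (- (\<i> * of_real (\<omega> e)) * of_real t) -
      \<i> * u e r * of_real (M e r / c e r)) < \<eta>)" if r: "r < k" for r
  proof -
    have unit: "cmod (\<i> * u e r * of_real (M e r / c e r)) = 1" if "e < k" for e
      using u[OF that r] abs_M[OF that r] c[OF that r] by (simp add: norm_mult norm_divide)
    show ?thesis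
      by (rule Kronecker_unit_circle_large[where B = "\<rho> / \<bar>a r\<bar>" and
            u = "\<lambda>e. \<i> * u e r * of_real (M e r / c e r)", OF indep unit \<open>0 < \<eta>\<close>]) blast+
  qed
  then obtain t where t: "\<And>r. r < k \<Longrightarrow> t r > \<rho> / \<bar>a r\<bar>"
    and t_near: "\<And>e r. e < k \<Longrightarrow> r < k \<Longrightarrow> cmod (exp (- (\<i> * of_real (\<omega> e)) * of_real (t r)) -
      \<i> * u e r * of_real (M e r / c e r)) < \<eta>"
    by metis
  define v where "v = (\<lambda>e r. of_real (c e r) * exp (- (\<i> * of_real (\<omega> e)) * of_real (t r)))"
  have v_norm: "cmod (v e r) \<le> C" if "e < k" "r < k" for e r
    using C_ge[OF that] by (simp add: v_def norm_mult)
  have v_near: "cmod (v e r - \<i> * u e r * of_real (M e r)) \<le> C * \<eta>" if er: "e < k" "r < k" for e r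
  proof -
    have "v e r - \<i> * u e r * of_real (M e r) = of_real (c e r) *
        (exp (- (\<i> * of_real (\<omega> e)) * of_real (t r)) - \<i> * u e r * of_real (M e r / c e r))"
      using c[OF er] by (simp add: v_def right_diff_distrib)
    also have "cmod \<dots> \<le> C * \<eta>"
      unfolding norm_mult using C_ge[OF er] t_near[OF er] \<open>C \<ge> 0\<close> by (intro mult_mono) auto
    finally show ?thesis .
  qed
  have v_near': "cmod (v e r - \<i> * of_real (M e r)) \<le> C * (2 * \<eta>1)" if er: "e < k" "r < k" for e r
  proof -
    have "v e r - \<i> * of_real (M e r) = (v e r - \<i> * u e r * of_real (M e r)) + \<i> * of_real (M e r) * (u e r - 1)"
      by (simp add: algebra_simps)
    also have "cmod \<dots> \<le> C * \<eta> + C * \<eta>1"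
      using v_near[OF er] u[OF er] abs_M[OF er] C_ge[OF er] \<open>C \<ge> 0\<close>
      by (intro order.trans[OF norm_triangle_ineq] add_mono) (auto simp: norm_mult intro!: mult_mono)
    also have "\<dots> \<le> C * (2 * \<eta>1)"
      using mult_left_mono[OF \<eta>(2) \<open>C \<ge> 0\<close>] by simp
    finally show ?thesis .
  qed

  define h where "h = (\<lambda>e r z. of_real (a r + Im z) * exp (- (\<i> * of_real (\<omega> e / a r * Re z))))"
  define l where "l = (\<lambda>e z. of_real (Im z) - \<i> * of_real (\<omega> e * Re z))"
  \<comment> \<open>i times \<open>l e z\<close> is \<omega> e Re z + i Im z. Dividing the real part
    by \<omega> e gives back z, so the linearization becomes the same \<open>M\<close> for both
    parts of z.\<close>
  define scale where "scale = (\<lambda>e w. Complex (Re w / \<omega> e) (Im w))"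
  have scale_norm: "cmod (scale e w) \<le> R * cmod w" if e: "e < k" for e w
  proof -
    have "cmod (scale e w) \<le> \<bar>Re w / \<omega> e\<bar> + \<bar>Im w\<bar>"
      unfolding scale_def using cmod_le[of "Complex (Re w / \<omega> e) (Im w)"] by simp
    also have "\<dots> \<le> cmod w / \<omega> e + cmod w"
      using pos[OF e] abs_Re_le_cmod[of w] abs_Im_le_cmod[of w]
      by (intro add_mono) (auto simp: divide_right_mono)
    also have "\<dots> = (1 + 1 / \<omega> e) * cmod w"
      by (simp add: algebra_simps)
    also have "\<dots> \<le> R * cmod w"
      using R_ge[OF e] by (intro mult_right_mono) auto
    finally show ?thesis .
  qed
  have scale_diff: "scale e w - scale e w' = scale e (w - w')" for e w w'
    by (simp add: scale_def complex_eq_iff diff_divide_distrib)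
  have scale_linear: "(\<Sum>r<k. of_real (M e r) * z r) = scale e (\<Sum>r<k. \<i> * of_real (M e r) * l e (z r))"
    if e: "e < k" for e z
    using pos[OF e] by (simp add: scale_def l_def complex_eq_iff sum_divide_distrib mult.left_commute)
  define N where "N = (\<lambda>z e. scale e ((\<Sum>r<k. v e r * h e r (z r)) - \<i> * of_real (\<omega> e)))"

  have "\<exists>z. (\<Sum>r<k. cmod (z r)) \<le> \<rho> \<and> (\<forall>e<k. N z e = 0)"
  proof (rule simplified_newton_zero[where M = M and P = P, OF MP PM])
    fix x y :: "nat \<Rightarrow> complex" and e
    assume e: "e < k" and x: "(\<Sum>r<k. cmod (x r)) \<le> \<rho>" and y: "(\<Sum>r<k. cmod (y r)) \<le> \<rho>"
    have coord: "cmod (z r) \<le> \<rho>" if "(\<Sum>r<k. cmod (z r)) \<le> \<rho>" "r < k" for z r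
      using that member_le_sum[of r "{..<k}" "\<lambda>r. cmod (z r)"] by auto
    have "N x e - N y e - (\<Sum>r<k. of_real (M e r) * (x r - y r)) =
        scale e (\<Sum>r<k. v e r * (h e r (x r) - h e r (y r)) - \<i> * of_real (M e r) * l e (x r - y r))"
      unfolding N_def scale_linear[OF e] scale_diff
      by (simp add: sum_subtractf right_diff_distrib)
    also have "cmod \<dots> \<le> R * (\<Sum>r<k. (C * L e r * \<rho> + C * (2 * \<eta>1) * W) * cmod (x r - y r))"
    proof (intro order.trans[OF scale_norm[OF e]] mult_left_mono order.trans[OF norm_sum] sum_mono)
      fix r assume "r \<in> {..<k}"
      then have r: "r < k"
        by simp
      \<comment> \<open>First the nonlinear remainder, controlled by \<open>\<rho>\<close>; then the
        error of replacing the base value \<open>v e r\<close> by i M e r, controlled by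
        \<open>\<eta>1\<close>.\<close>
      have "v e r * (h e r (x r) - h e r (y r)) - \<i> * of_real (M e r) * l e (x r - y r) =
          v e r * (h e r (x r) - h e r (y r) - l e (x r - y r)) + (v e r - \<i> * of_real (M e r)) * l e (x r - y r)"
        by (simp add: algebra_simps)
      also have "cmod \<dots> \<le> C * (L e r * \<rho> * cmod (x r - y r)) + C * (2 * \<eta>1) * (W * cmod (x r - y r))"
      proof (intro order.trans[OF norm_triangle_ineq] add_mono; unfold norm_mult; rule mult_mono)
        show "cmod (h e r (x r) - h e r (y r) - l e (x r - y r)) \<le> L e r * \<rho> * cmod (x r - y r)"
          unfolding h_def l_def L_def
          by (rule phase_amplitude_lipschitz) (use \<rho> a[OF r] coord[OF x r] coord[OF y r] in auto)
        have "cmod (l e (x r - y r)) \<le> cmod (x r - y r) + \<omega> e * cmod (x r - y r)"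
          unfolding l_def using abs_Re_le_cmod[of "x r - y r"] abs_Im_le_cmod[of "x r - y r"] pos[OF e]
          by (intro order.trans[OF norm_triangle_ineq4] add_mono)
             (simp_all only: norm_mult norm_ii norm_of_real abs_mult mult_1_left abs_of_pos mult_left_mono less_imp_le)
        also have "\<dots> \<le> W * cmod (x r - y r)"
          using mult_right_mono[OF W_ge[OF e], of "cmod (x r - y r)"] by (simp add: algebra_simps)
        finally show "cmod (l e (x r - y r)) \<le> W * cmod (x r - y r)" .
      qed (use v_norm[OF e r] v_near'[OF e r] \<open>C \<ge> 0\<close> \<eta>1 in auto)
      also have "\<dots> = (C * L e r * \<rho> + C * (2 * \<eta>1) * W) * cmod (x r - y r)"
        by (simp add: algebra_simps)
      finally show "cmod (v e r * (h e r (x r) - h e r (y r)) - \<i> * of_real (M e r) * l e (x r - y r)) \<le> \<dots>" .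
    qed (use \<open>R > 0\<close> in auto)
    also have "\<dots> = (\<Sum>r<k. ((R * C * L e r) * \<rho> + (R * C * 2 * W) * \<eta>1) * cmod (x r - y r))"
      by (simp add: sum_distrib_left algebra_simps)
    also have "\<dots> \<le> (\<Sum>r<k. \<epsilon> * cmod (x r - y r))"
      using \<rho>(3)[OF e] \<eta>1(2) by (intro sum_mono mult_right_mono) fastforce+
    also have "\<dots> = \<epsilon> * (\<Sum>r<k. cmod (x r - y r))"
      by (simp add: sum_distrib_left)
    finally show "cmod (N x e - N y e - (\<Sum>r<k. of_real (M e r) * (x r - y r))) \<le> \<epsilon> * (\<Sum>r<k. cmod (x r - y r))" .
  next
    fix e assume e: "e < k"
    \<comment> \<open>By \<open>Mu\<close> the rotated phases solve the equation exactly, so the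
      residual at 0 is only the Kronecker error of size \<open>\<eta>\<close>.\<close>
    have "(\<Sum>r<k. v e r * h e r 0) - \<i> * of_real (\<omega> e) = (\<Sum>r<k. (v e r - \<i> * u e r * of_real (M e r)) * of_real (a r))"
      unfolding Mu[OF e, symmetric] sum_distrib_left sum_subtractf[symmetric]
      by (intro sum.cong) (auto simp: h_def algebra_simps)
    also have "cmod \<dots> \<le> (\<Sum>r<k. C * \<eta> * \<bar>a r\<bar>)"
      using v_near[OF e]
      by (intro order.trans[OF norm_sum] sum_mono) (auto simp: norm_mult intro!: mult_right_mono)
    also have "\<dots> = C * \<eta> * S"
      by (simp add: S_def sum_distrib_left)
    finally have "R * cmod ((\<Sum>r<k. v e r * h e r 0) - \<i> * of_real (\<omega> e)) \<le> R * (C * \<eta> * S)"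
      using \<open>R > 0\<close> by (intro mult_left_mono) auto
    then show "cmod (N (\<lambda>_. 0) e) \<le> R * (C * \<eta> * S)"
      unfolding N_def using scale_norm[OF e] order.trans by blast
  qed (use K_\<epsilon> \<eta> \<rho> in \<open>auto simp: K_def mult_ac\<close>)
  then obtain z where z: "(\<Sum>r<k. cmod (z r)) \<le> \<rho>" and zero: "\<And>e. e < k \<Longrightarrow> N z e = 0"
    by blast
  define \<tau> where "\<tau> = (\<lambda>r. t r + Re (z r) / a r)"
  define b where "b = (\<lambda>r. a r + Im (z r))"
  show ?thesis
  proof (rule that[of \<tau> b])
    fix r assume r: "r < k"
    have "\<bar>Re (z r)\<bar> \<le> \<rho>"
      using z abs_Re_le_cmod[of "z r"] member_le_sum[of r "{..<k}" "\<lambda>r. cmod (z r)"] r by auto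
    then have "\<bar>Re (z r) / a r\<bar> \<le> \<rho> / \<bar>a r\<bar>"
      by (simp add: divide_right_mono)
    with t[OF r] show "\<tau> r > 0"
      unfolding \<tau>_def by linarith
  next
    fix e assume e: "e < k"
    define w where "w = (\<Sum>r<k. v e r * h e r (z r)) - \<i> * of_real (\<omega> e)"
    have "scale e w = 0"
      using zero[OF e] by (simp add: N_def w_def)
    then have "w = 0"
      using pos[OF e] by (auto simp: scale_def complex_eq_iff)
    have "(\<Sum>r<k. of_real (c e r * b r) * exp (- (\<i> * of_real (\<omega> e)) * of_real (\<tau> r))) = (\<Sum>r<k. v e r * h e r (z r))"
    proof (intro sum.cong refl)
      fix r
      have "exp (- (\<i> * of_real (\<omega> e)) * of_real (\<tau> r)) =
          exp (- (\<i> * of_real (\<omega> e)) * of_real (t r)) * exp (- (\<i> * of_real (\<omega> e / a r * Re (z r))))"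
        unfolding exp_add[symmetric] by (simp add: \<tau>_def algebra_simps)
      then show "of_real (c e r * b r) * exp (- (\<i> * of_real (\<omega> e)) * of_real (\<tau> r)) = v e r * h e r (z r)"
        by (simp add: v_def h_def b_def)
    qed
    also have "\<dots> = \<i> * of_real (\<omega> e)"
      using \<open>w = 0\<close> by (simp add: w_def)
    finally show "(\<Sum>r<k. of_real (c e r * b r) * exp (- (\<i> * of_real (\<omega> e)) * of_real (\<tau> r))) = \<i> * of_real (\<omega> e)" .
  qed
qed

section \<open>The factors as exponential sums\<close>

text \<open>A zero would make 4 q j equal to n times an odd integer, which is impossible by
  parity.\<close>

lemma cos_two_pi_odd_denominator_nonzero:
  fixes j :: nat
  assumes "odd n"
  shows "cos (2 * pi * real q * real j / real n) \<noteq> 0"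
proof
  assume "cos (2 * pi * real q * real j / real n) = 0"
  then obtain i where i: "odd i" "2 * pi * real q * real j / real n = of_int i * (pi / 2)"
    using cos_zero_iff_int by blast
  have "n > 0"
    using assms by (simp add: odd_pos)
  then have "pi * (4 * real q * real j) = pi * (of_int i * real n)"
    using i(2) by (simp add: field_simps)
  then have "4 * real q * real j = of_int i * real n"
    by simp
  then have "real_of_int (4 * int q * int j) = real_of_int (i * int n)"
    by simp
  then have "4 * int q * int j = i * int n"
    by (simp only: of_int_eq_iff)
  then have "even (i * int n)"
    by (metis dvd_mult2 even_numeral)
  with i(1) assms show False
    by simp
qed

text \<open>The consecutive blocks tile the positions after \<open>p\<close>, and \<kappa> r is the
  cell whose block contains r. One \<kappa> serves all \<open>x\<close> and \<open>f\<close>,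
  because delays and coefficients are chosen only later.\<close>

lemma coupling_sum_reindex:
  "\<exists>\<kappa> :: nat \<Rightarrow> nat. \<forall>(x :: nat \<Rightarrow> complex) f.
     (\<Sum>q = 2..<Q. x q * (\<Sum>t = 1..m q. f (coupling_index p m q t)))
       = (\<Sum>r \<in> {p<..p + (\<Sum>q = 2..<Q. m q)}. x (\<kappa> r) * f r)"
proof (induction Q)
  case 0
  show ?case
    by simp
next
  case (Suc Q)
  show ?case
  proof (cases "2 \<le> Q")
    case False
    then show ?thesis
      by simp
  next
    case True
    obtain \<kappa> where \<kappa>: "\<And>(x :: nat \<Rightarrow> complex) f.
        (\<Sum>q = 2..<Q. x q * (\<Sum>t = 1..m q. f (coupling_index p m q t)))
          = (\<Sum>r \<in> {p<..p + (\<Sum>q = 2..<Q. m q)}. x (\<kappa> r) * f r)"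
      using Suc by blast
    define b where "b = p + (\<Sum>q = 2..<Q. m q)"
    define \<kappa>' where "\<kappa>' = (\<lambda>r. if b < r then Q else \<kappa> r)"
    have "(\<Sum>q = 2..<Suc Q. x q * (\<Sum>t = 1..m q. f (coupling_index p m q t)))
        = (\<Sum>r \<in> {p<..p + (\<Sum>q = 2..<Suc Q. m q)}. x (\<kappa>' r) * f r)" for x :: "nat \<Rightarrow> complex" and f
    proof -
      have "(\<Sum>q = 2..<Suc Q. x q * (\<Sum>t = 1..m q. f (coupling_index p m q t)))
          = (\<Sum>r \<in> {p<..b}. x (\<kappa> r) * f r) + x Q * (\<Sum>t = 1..m Q. f (b + t))"
        using True \<kappa>[of x f] by (simp add: coupling_index_def b_def)
      also have "(\<Sum>r \<in> {p<..b}. x (\<kappa> r) * f r) = (\<Sum>r \<in> {p<..b}. x (\<kappa>' r) * f r)"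
        by (intro sum.cong) (auto simp: \<kappa>'_def)
      also have "(\<Sum>t = 1..m Q. f (b + t)) = (\<Sum>r \<in> {b<..b + m Q}. f r)"
        by (rule sum.reindex_bij_witness[of _ "\<lambda>r. r - b" "\<lambda>t. b + t"]) auto
      also have "x Q * \<dots> = (\<Sum>r \<in> {b<..b + m Q}. x (\<kappa>' r) * f r)"
        unfolding sum_distrib_left by (intro sum.cong) (auto simp: \<kappa>'_def)
      also have "(\<Sum>r \<in> {p<..b}. x (\<kappa>' r) * f r) + \<dots> = (\<Sum>r \<in> {p<..b} \<union> {b<..b + m Q}. x (\<kappa>' r) * f r)"
        by (intro sum.union_disjoint[symmetric]) auto
      also have "{p<..b} \<union> {b<..b + m Q} = {p<..p + (\<Sum>q = 2..<Suc Q. m q)}"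
        using True by (auto simp: b_def)
      finally show ?thesis .
    qed
    then show ?thesis
      by blast
  qed
qed

lemma char_factor_single_sum:
  obtains \<kappa> :: "nat \<Rightarrow> nat" where "\<And>\<tau> a j z. char_factor n p m \<tau> a j z = z -
    (\<Sum>r = 1..num_delays n p m. of_real ((if r \<le> p then 1 else 4 * cos (2 * pi * real (\<kappa> r) * real j / real n)) * a r)
      * exp (- z * of_real (\<tau> r)))"
proof -
  define k where "k = num_delays n p m"
  have k: "p + (\<Sum>q = 2..(n + 1) div 2. m q) = k"
    by (simp add: k_def num_delays_def)
  obtain \<kappa> where \<kappa>: "\<And>(x :: nat \<Rightarrow> complex) f.
      (\<Sum>q = 2..(n + 1) div 2. x q * (\<Sum>t = 1..m q. f (coupling_index p m q t)))
        = (\<Sum>r \<in> {p<..k}. x (\<kappa> r) * f r)"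
    using coupling_sum_reindex[where Q = "Suc ((n + 1) div 2)" and m = m and p = p] unfolding atLeastLessThanSuc_atLeastAtMost k
    by blast
  define C where "C = (\<lambda>j r. if r \<le> p then 1 else 4 * cos (2 * pi * real (\<kappa> r - 1) * real j / real n))"
  have "char_factor n p m \<tau> a j z = z - (\<Sum>r = 1..k. of_real (C j r * a r) * exp (- z * of_real (\<tau> r)))" for \<tau> a j z
  proof -
    define g where "g = (\<lambda>r. of_real (C j r * a r) * exp (- z * of_real (\<tau> r)))"
    have "internal_term p \<tau> a z = (\<Sum>r = 1..p. g r)"
      unfolding internal_term_def by (intro sum.cong) (auto simp: g_def C_def)
    moreover have "coupling_term n p m \<tau> a j z = (\<Sum>r \<in> {p<..k}. g r)"
      unfolding coupling_term_def
        \<kappa>[of "\<lambda>q. of_real (4 * cos (2 * pi * real (q - 1) * real j / real n))"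
          "\<lambda>r. of_real (a r) * exp (- z * of_real (\<tau> r))"]
      by (intro sum.cong) (auto simp: g_def C_def)
    moreover have "(\<Sum>r = 1..p. g r) + (\<Sum>r \<in> {p<..k}. g r) = (\<Sum>r \<in> {1..p} \<union> {p<..k}. g r)"
      by (intro sum.union_disjoint[symmetric]) auto
    moreover have "{1..p} \<union> {p<..k} = {1..k}"
      using k by auto
    ultimately show ?thesis
      by (simp add: char_factor_def g_def diff_diff_eq)
  qed
  then show ?thesis
    \<comment> \<open>The cosine for cell q contains q - 1.\<close>
    by (intro that[of "\<lambda>r. \<kappa> r - 1"]) (simp add: C_def k_def)
qed

theorem theorem3p7:
  fixes n p k s :: nat
    and m :: "nat \<Rightarrow> nat"
    and A :: "(nat \<Rightarrow> real) \<Rightarrow> nat \<Rightarrow> real mat"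
    and i :: "nat \<Rightarrow> nat"
    and L :: "nat \<Rightarrow> nat"
    and \<omega> :: "nat \<Rightarrow> nat \<Rightarrow> real"
  assumes "odd n"
    and "p \<ge> 1"
    and "k = num_delays n p m"
    and "\<And>a r. r \<in> {1..k} \<Longrightarrow> A a r \<in> carrier_mat n n"
    and "\<And>\<tau> a. (\<forall>r\<in>{1..k}. \<tau> r > 0) \<Longrightarrow> dihedral_symmetric n k \<tau> (A a)"
    and "\<And>\<tau> a z. (\<forall>r\<in>{1..k}. \<tau> r > 0) \<Longrightarrow>
           Determinant.det (char_matrix n k \<tau> (A a) z) =
             char_factor n p m \<tau> a 0 z * (\<Prod>j = 1..(n - 1) div 2. (char_factor n p m \<tau> a j z)\<^sup>2)"
    and "s \<ge> 1"
    and "strict_mono_on {1..s} i"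
    and "\<And>u. u \<in> {1..s} \<Longrightarrow> i u \<le> (n - 1) div 2"
    and "Determinant.det (combination_mat n s i) \<noteq> 0"
    and "\<And>u. u \<in> {1..s} \<Longrightarrow> L (i u) \<ge> 1"
    and "(\<Sum>u = 1..s. L (i u)) = k"
    and "\<And>u l. u \<in> {1..s} \<Longrightarrow> l \<in> {1..L (i u)} \<Longrightarrow> \<omega> u l > 0"
    and "rat_independent_family (\<lambda>(u, l). \<omega> u l) (SIGMA u:{1..s}. {1..L (i u)})"
  shows "\<exists>(\<tau> :: nat \<Rightarrow> real) (a :: nat \<Rightarrow> real).
           (\<forall>r\<in>{1..k}. \<tau> r > 0) \<and>
           (\<forall>u\<in>{1..s}. \<forall>l\<in>{1..L (i u)}.
              char_factor n p m \<tau> a (i u) (\<i> * complex_of_real (\<omega> u l)) = 0)"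
proof -
  \<comment> \<open>One equation per frequency; there are \<open>k\<close> of them, as many as there
    are delays, which makes the system of multipliers square.\<close>
  define I where "I = (SIGMA u:{1..s}. {1..L (i u)})"
  have "finite I" "card I = k"
    using assms(12) by (simp_all add: I_def)
  then obtain f where f: "bij_betw f {..<k} I"
    using ex_bij_betw_nat_finite[of I] by (auto simp: atLeast0LessThan)
  obtain \<kappa> where \<kappa>: "\<And>\<tau> a j z. char_factor n p m \<tau> a j z = z -
    (\<Sum>r = 1..k. of_real ((if r \<le> p then 1 else 4 * cos (2 * pi * real (\<kappa> r) * real j / real n)) * a r)
      * exp (- z * of_real (\<tau> r)))"
    using char_factor_single_sum[of n p m] unfolding \<open>k = num_delays n p m\<close> by blast
  define C where "C = (\<lambda>j r. if r \<le> p then 1 else 4 * cos (2 * pi * real (\<kappa> r) * real j / real n))"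
  define w where "w = (\<lambda>e. case f e of (u, l) \<Rightarrow> \<omega> u l)"
  \<comment> \<open>\<open>Suc\<close> passes from columns counted from 0 to positions counted from
    1. Position 1 is internal because 1 \<le> p, so column 0 is constantly 1.\<close>
  define c where "c = (\<lambda>e r. C (i (fst (f e))) (Suc r))"
  have "1 \<le> k"
    using assms(2,3) by (simp add: num_delays_def)
  moreover have "c e r \<noteq> 0" for e r
    using cos_two_pi_odd_denominator_nonzero[OF \<open>odd n\<close>] by (simp add: c_def C_def)
  moreover have "c e 0 = 1" for e
    using assms(2) by (simp add: c_def C_def)
  moreover have "w e > 0" if "e < k" for e
  proof -
    have "f e \<in> I"
      using f that by (auto dest: bij_betwE)
    then show ?thesis
      using assms(13) by (auto simp: w_def I_def)
  qed
  moreover have "rat_independent_family w {..<k}"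
  proof -
    have w: "w = (\<lambda>(u, l). \<omega> u l) \<circ> f"
      by (simp add: w_def fun_eq_iff)
    have image: "f ` {..<k} = I"
      using f by (rule bij_betw_imp_surj_on)
    have "inj_on f {..<k}"
      using f by (rule bij_betw_imp_inj_on)
    then show ?thesis
      using assms(14) unfolding rat_independent_family_def w image_comp[symmetric] image I_def[symmetric]
      by (auto intro: comp_inj_on simp: image)
  qed
  ultimately obtain \<tau> a where pos: "\<And>r. r < k \<Longrightarrow> \<tau> r > 0" and
    root: "\<And>e. e < k \<Longrightarrow> (\<Sum>r<k. of_real (c e r * a r) * exp (- (\<i> * of_real (w e)) * of_real (\<tau> r)))
      = \<i> * of_real (w e)"
    using prescribed_imaginary_roots[of k c w] by blast
  show ?thesis
  proof (intro exI conjI ballI)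
    fix r assume "r \<in> {1..k}"
    then show "\<tau> (r - 1) > 0"
      by (intro pos) auto
  next
    fix u l assume "u \<in> {1..s}" "l \<in> {1..L (i u)}"
    then have "(u, l) \<in> f ` {..<k}"
      using f by (simp add: I_def bij_betw_def)
    then obtain e where e: "e < k" "f e = (u, l)"
      by auto
    have "char_factor n p m (\<lambda>r. \<tau> (r - 1)) (\<lambda>r. a (r - 1)) (i u) (\<i> * of_real (\<omega> u l))
        = \<i> * of_real (\<omega> u l) - (\<Sum>r<k. of_real (c e r * a r) * exp (- (\<i> * of_real (w e)) * of_real (\<tau> r)))"
      unfolding \<kappa> by (simp add: sum.atLeast1_atMost_eq C_def c_def w_def e(2) cong: if_cong)
    then show "char_factor n p m (\<lambda>r. \<tau> (r - 1)) (\<lambda>r. a (r - 1)) (i u) (\<i> * of_real (\<omega> u l)) = 0"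
      using root[OF e(1)] by (simp add: w_def e(2))
  qed
qed

end
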